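(* Let $(\alpha,\beta)\in\{O,\overline{O}\}\times\{R,\overline{R}\}$ with $(\alpha,\beta)\neq(O,R)$. For every labeled-example triple $(C,Z,\models)$, $$\mathrm{MAP\text{-}TD}^{\alpha,\beta}(C)\ \le\ \mathrm{MLE\text{-}TD}^{\alpha,\beta}(C)\ \le\ 1+\mathrm{MAP\text{-}TD}^{\alpha,\beta}(C).$$ Moreover, there exist concept classes $C'$ and $C''$ (of labeled-example form) such that $$\mathrm{MLE\text{-}TD}^{\alpha,\beta}(C')=\mathrm{MAP\text{-}TD}^{\alpha,\beta}(C')\quad\text{and}\quad \mathrm{MLE\text{-}TD}^{\alpha,\beta}(C'')=1+\mathrm{MAP\text{-}TD}^{\alpha,\beta}(C'').$$
   Context: A labeled-example triple $(C,Z,\models)$: $X$ is a non-empty finite set, $C$ is a family of subsets of $X$ with $|C|\ge 2$, $Z=X\times\{0,1\}$, and $c\models(x,b)$ if and only if ($b=1$ and $x\in c$) or ($b=0$ and $x\notin c$). Sampling modes are pairs $(\alpha,\beta)\in\{O,\overline{O}\}\times\{R,\overline{R}\}$ (ordered/unordered, with/without replacement). $\mathcal{Z}^{O,R}$ is the set of finite sequences over $Z$; $\mathcal{Z}^{\overline{O},R}$ the set of finite multisets over $Z$; $\mathcal{Z}^{O,\overline{R}}$ the set of repetition-free sequences over $Z$; $\mathcal{Z}^{\overline{O},\overline{R}}=2^Z$. The empty sequence/multiset/set is included and denoted $\emptyset$; $|I|$ is the length of a sequence or the cardinality (with multiplicity) of a (multi)set. For a probability vector $Q=(q(z))_{z\in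 Z}$: for a multiset $A$ of size $n$ with distinct elements $z'_1,\dots,z'_k$ of multiplicities $n_1,\dots,n_k$, $P^{\overline{O},R}(A|Q)=\frac{n!}{n_1!\cdots n_k!}\prod_{i=1}^k q(z'_i)^{n_i}$; for a repetition-free sequence with $n\le|\{z:q(z)>0\}|$, $P^{O,\overline{R}}((z_1,\dots,z_n)|Q)=\prod_{i=1}^n \frac{q(z_i)}{1-(q(z_1)+\dots+q(z_{i-1}))}$; for a set $A=\{z_1,\dots,z_n\}$ of size $n\le|\{z:q(z)>0\}|$, $P^{\overline{O},\overline{R}}(A|Q)=\sum_\sigma P^{O,\overline{R}}((z_{\sigma(1)},\dots,z_{\sigma(n)})|Q)$ over all permutations $\sigma$ of $\{1,\dots,n\}$. The probability of $\emptyset$ is $1$ in every mode. A MAP-learner $L$ for $C$ is given by priors $P(c)>0$ with $\sum_{c\in C}P(c)=1$ and conditional likelihoods $P(z|c)\ge 0$ with $\sum_{z\in Z}P(z|c)=1$ for each $c\in C$, subject to: $c\not\models z$ implies $P(z|c)=0$. An MLE-learner is a MAP-learner with uniform priors. Write $P^{\alpha,\beta}(I|c)$ for $P^{\alpha,\beta}(I|P(\cdot|c))$ and $N^+(C,L)=\min_{c\in C}|\{z\in Z:P(z|c)>0\}|$. A teacher for $L$ in mode $(\alpha,\beta)$ is a map $T:C\to\mathcal{Z}^{\alpha,\beta}$ such that for every $c_0\in C$: if $\beta=\overline{R}$ then $|T(c_0)|\le N^+(C,L)$; and $c_0$ is the unique maximizer over $c\in C$ of $P(c)\cdot P^{\alpha,\beta}(T(c_0)|c)$.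 Its order is $\max_{c\in C}|T(c)|$. $\mathrm{MAP\text{-}TD}^{\alpha,\beta}_L(C)$ is the smallest order of a teacher for $L$ in mode $(\alpha,\beta)$ ($\infty$ if none exists). $\mathrm{MAP\text{-}TD}^{\alpha,\beta}(C)$ (resp. $\mathrm{MLE\text{-}TD}^{\alpha,\beta}(C)$) is the minimum of $\mathrm{MAP\text{-}TD}^{\alpha,\beta}_L(C)$ over all MAP-learners (resp. all MLE-learners) $L$ for $C$. *)

theory Defs
  imports Complex_Main "HOL-Library.Multiset" "HOL-Library.Extended_Nat"
    "HOL-Combinatorics.Multiset_Permutations"
begin

text \<open>Labeled examples: the label set \<open>{0,1}\<close> is \<^typ>\<open>bool\<close>, with \<open>True\<close> for 1.\<close>

type_synonym 'a example = "'a \<times> bool"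

definition labeled_examples :: "'a set \<Rightarrow> 'a example set" where
  "labeled_examples X = X \<times> UNIV"

fun models :: "'a set \<Rightarrow> 'a example \<Rightarrow> bool" where
  "models c (x, b) \<longleftrightarrow> (b \<and> x \<in> c) \<or> (\<not> b \<and> x \<notin> c)"

text \<open>\<open>Z\<close> and the consistency relation are functions of \<open>X\<close>, so a labeled-example triple
  is represented by the domain \<open>X\<close> and the concept class \<open>C\<close>.\<close>

definition labeled_example_triple :: "'a set \<Rightarrow> 'a set set \<Rightarrow> bool" where
  "labeled_example_triple X C \<longleftrightarrow> finite X \<and> X \<noteq> {} \<and> C \<subseteq> Pow X \<and> card C \<ge> 2"

datatype ordering = Ordered | Unordered

datatype replacement = With_Repl | Without_Repl

text \<open>A common type for the samples of all four modes; \<open>samples\<close> selects those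
  belonging to a given mode.\<close>

datatype 'z sample = Seq "'z list" | MSet "'z multiset" | FSet "'z set"

fun samples :: "ordering \<Rightarrow> replacement \<Rightarrow> 'z set \<Rightarrow> 'z sample set" where
  "samples Ordered With_Repl Z = Seq ` lists Z"
| "samples Unordered With_Repl Z = MSet ` {A. set_mset A \<subseteq> Z}"
| "samples Ordered Without_Repl Z = Seq ` {zs \<in> lists Z. distinct zs}"
| "samples Unordered Without_Repl Z = FSet ` Pow Z"

primrec sample_size :: "'z sample \<Rightarrow> nat" where
  "sample_size (Seq zs) = length zs"
| "sample_size (MSet A) = size A"
| "sample_size (FSet A) = card A"

definition prob_seq_repl :: "('z \<Rightarrow> real) \<Rightarrow> 'z list \<Rightarrow> real" where
  "prob_seq_repl q zs = (\<Prod>i<length zs. q (zs ! i))"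

definition prob_mset_repl :: "('z \<Rightarrow> real) \<Rightarrow> 'z multiset \<Rightarrow> real" where
  "prob_mset_repl q A =
     fact (size A) / (\<Prod>z\<in>set_mset A. fact (count A z)) * (\<Prod>z\<in>set_mset A. q z ^ count A z)"

text \<open>Used only for repetition-free sequences that are no longer than the support of \<open>q\<close>;
  the denominators are then nonzero.\<close>

definition prob_seq_norepl :: "('z \<Rightarrow> real) \<Rightarrow> 'z list \<Rightarrow> real" where
  "prob_seq_norepl q zs = (\<Prod>i<length zs. q (zs ! i) / (1 - (\<Sum>j<i. q (zs ! j))))"

text \<open>\<^const>\<open>permutations_of_set\<close> yields the duplicate-free enumerations of \<open>A\<close>, one for each
  permutation of its indices.\<close>

definition prob_set_norepl :: "('z \<Rightarrow> real) \<Rightarrow> 'z set \<Rightarrow> real" where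
  "prob_set_norepl q A = (\<Sum>zs\<in>permutations_of_set A. prob_seq_norepl q zs)"

text \<open>The ordering mode is determined by the constructor of the sample, and for multisets
  and sets so is the replacement mode.\<close>

primrec sample_prob :: "replacement \<Rightarrow> ('z \<Rightarrow> real) \<Rightarrow> 'z sample \<Rightarrow> real" where
  "sample_prob \<beta> q (Seq zs) =
     (case \<beta> of With_Repl \<Rightarrow> prob_seq_repl q zs | Without_Repl \<Rightarrow> prob_seq_norepl q zs)"
| "sample_prob \<beta> q (MSet A) = prob_mset_repl q A"
| "sample_prob \<beta> q (FSet A) = prob_set_norepl q A"

record 'a learner =
  prior :: "'a set \<Rightarrow> real"
  likelihood :: "'a set \<Rightarrow> 'a example \<Rightarrow> real"

definition MAP_learner :: "'a set \<Rightarrow> 'a set set \<Rightarrow> 'a learner \<Rightarrow> bool" where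
  "MAP_learner X C L \<longleftrightarrow>
     (\<forall>c\<in>C. prior L c > 0) \<and> (\<Sum>c\<in>C. prior L c) = 1 \<and>
     (\<forall>c\<in>C. (\<forall>z\<in>labeled_examples X. likelihood L c z \<ge> 0) \<and>
            (\<Sum>z\<in>labeled_examples X. likelihood L c z) = 1 \<and>
            (\<forall>z\<in>labeled_examples X. \<not> models c z \<longrightarrow> likelihood L c z = 0))"

definition MLE_learner :: "'a set \<Rightarrow> 'a set set \<Rightarrow> 'a learner \<Rightarrow> bool" where
  "MLE_learner X C L \<longleftrightarrow> MAP_learner X C L \<and> (\<forall>c\<in>C. prior L c = 1 / real (card C))"

definition N_plus :: "'a set \<Rightarrow> 'a set set \<Rightarrow> 'a learner \<Rightarrow> nat" where
  "N_plus X C L = Min ((\<lambda>c. card {z \<in> labeled_examples X. likelihood L c z > 0}) ` C)"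

definition unique_maximizer :: "('c \<Rightarrow> real) \<Rightarrow> 'c set \<Rightarrow> 'c \<Rightarrow> bool" where
  "unique_maximizer f S c0 \<longleftrightarrow> {c. is_arg_max f (\<lambda>c. c \<in> S) c} = {c0}"

definition is_teacher ::
  "ordering \<Rightarrow> replacement \<Rightarrow> 'a set \<Rightarrow> 'a set set \<Rightarrow> 'a learner \<Rightarrow>
   ('a set \<Rightarrow> 'a example sample) \<Rightarrow> bool" where
  "is_teacher \<alpha> \<beta> X C L T \<longleftrightarrow>
     (\<forall>c0\<in>C. T c0 \<in> samples \<alpha> \<beta> (labeled_examples X) \<and>
       (\<beta> = Without_Repl \<longrightarrow> sample_size (T c0) \<le> N_plus X C L) \<and>
       unique_maximizer (\<lambda>c. prior L c * sample_prob \<beta> (likelihood L c) (T c0)) C c0)"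

definition teacher_order :: "'a set set \<Rightarrow> ('a set \<Rightarrow> 'a example sample) \<Rightarrow> nat" where
  "teacher_order C T = Max ((\<lambda>c. sample_size (T c)) ` C)"

text \<open>In \<^typ>\<open>enat\<close> the infimum of a nonempty set is its minimum, and that of the empty set
  is \<open>\<infinity>\<close>.\<close>

definition MAP_TD_learner ::
  "ordering \<Rightarrow> replacement \<Rightarrow> 'a set \<Rightarrow> 'a set set \<Rightarrow> 'a learner \<Rightarrow> enat" where
  "MAP_TD_learner \<alpha> \<beta> X C L = (INF T \<in> {T. is_teacher \<alpha> \<beta> X C L T}. enat (teacher_order C T))"

definition MAP_TD :: "ordering \<Rightarrow> replacement \<Rightarrow> 'a set \<Rightarrow> 'a set set \<Rightarrow> enat" where
  "MAP_TD \<alpha> \<beta> X C = (INF L \<in> {L. MAP_learner X C L}. MAP_TD_learner \<alpha> \<beta> X C L)"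

definition MLE_TD :: "ordering \<Rightarrow> replacement \<Rightarrow> 'a set \<Rightarrow> 'a set set \<Rightarrow> enat" where
  "MLE_TD \<alpha> \<beta> X C = (INF L \<in> {L. MLE_learner X C L}. MAP_TD_learner \<alpha> \<beta> X C L)"

end

theory Submission
  imports Defs
begin

text \<open>
  A teacher \<open>T\<close> is injective and \<open>T c\<close> is consistent with \<open>c\<close>, since the maximum is unique and hence
  positive. Conversely, an injective consistent \<open>T\<close> is a teacher for a suitable MLE-learner as soon
  as no \<open>T c\<close> is empty and, for multisets, every \<open>T c\<close> has an element of multiplicity 1:
  for multisets take the empirical distribution of \<open>T c\<close> (Gibbs' inequality); for sets put weight 1
  on \<open>T c\<close> and a tiny weight on the other consistent examples; for sequences let the weights
  decrease geometrically along \<open>T c\<close>. In the last two modes \<open>T c\<close> has probability above \<open>1/2\<close>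
  under \<open>c\<close>, whereas any sample that omits an example at least as heavy as one it contains
  (or draws it later) is at most as likely as the sample obtained by swapping the two, hence has
  probability at most \<open>1/2\<close>.

  The samples of a MAP-teacher of order \<open>d < |X|\<close> that violate the extra condition are padded to
  size \<open>d + 1\<close> with new examples of multiplicity 1; they can be recovered from the result, so
  injectivity survives. If \<open>d \<ge> |X|\<close>, every concept is taught by all its consistent examples.

  The bound \<open>1 + MAP_TD\<close> is attained by seven concepts over three points: an MLE-teacher cannot use
  the empty sample, and there are only six samples of size 1.
\<close>

section \<open>Consistent examples and unique maximizers\<close>

definition consistent_examples :: "'a set \<Rightarrow> 'a set \<Rightarrow> 'a example set" where
  "consistent_examples X c = {z \<in> labeled_examples X. models c z}"

primrec sample_set :: "'z sample \<Rightarrow> 'z set" where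
  "sample_set (Seq zs) = set zs"
| "sample_set (MSet A) = set_mset A"
| "sample_set (FSet A) = A"

lemma consistent_examples_eq: "consistent_examples X c = (\<lambda>x. (x, x \<in> c)) ` X"
  by (auto simp: consistent_examples_def labeled_examples_def)

lemma finite_labeled_examples: "finite X \<Longrightarrow> finite (labeled_examples X)"
  by (simp add: labeled_examples_def)

lemma finite_consistent_examples: "finite X \<Longrightarrow> finite (consistent_examples X c)"
  by (simp add: consistent_examples_eq)

lemma consistent_examples_subset: "consistent_examples X c \<subseteq> labeled_examples X"
  by (auto simp: consistent_examples_def)

lemma card_consistent_examples: "card (consistent_examples X c) = card X"
  unfolding consistent_examples_eq by (rule card_image) (auto simp: inj_on_def)

text \<open>Each point of \<open>X\<close> occurs exactly once among the consistent examples, with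
  its label, so inclusion forces equal labels. Hence a sample consistent with one concept never
  exhausts the consistent examples of another.\<close>

lemma consistent_examples_subsetD:
  assumes "consistent_examples X c \<subseteq> consistent_examples X c'" "c \<subseteq> X" "c' \<subseteq> X"
  shows "c = c'"
  using assms by (auto simp: consistent_examples_eq)

lemma tripleD:
  assumes "labeled_example_triple X C"
  shows "finite X" "X \<noteq> {}" "finite C" "C \<noteq> {}" "card X > 0" "card C > 0"
    "\<And>c. c \<in> C \<Longrightarrow> c \<subseteq> X"
    "\<And>c. c \<in> C \<Longrightarrow> \<exists>c'\<in>C. c' \<noteq> c"
proof -
  show X: "finite X" "X \<noteq> {}" and sub: "\<And>c. c \<in> C \<Longrightarrow> c \<subseteq> X"
    using assms by (auto simp: labeled_example_triple_def)
  have 2: "card C \<ge> 2" using assms by (simp add: labeled_example_triple_def)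
  then show fin: "finite C" and ne: "C \<noteq> {}" and "card C > 0"
    by (auto intro: card_ge_0_finite)
  show "card X > 0" using X by (simp add: card_gt_0_iff)
  show "\<exists>c'\<in>C. c' \<noteq> c" if "c \<in> C" for c
  proof (rule ccontr)
    assume "\<not> ?thesis"
    then have "C \<subseteq> {c}" by auto
    then have "card C \<le> card {c}" by (intro card_mono) auto
    with 2 show False by simp
  qed
qed

lemma unique_maximizer_iff:
  "unique_maximizer f S c0 \<longleftrightarrow> c0 \<in> S \<and> (\<forall>c\<in>S. f c \<le> f c0) \<and>
     (\<forall>c\<in>S. (\<forall>c'\<in>S. f c' \<le> f c) \<longrightarrow> c = c0)"
  unfolding unique_maximizer_def is_arg_max_def set_eq_iff by (auto simp: not_less)

lemma unique_maximizerD: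
  assumes "unique_maximizer f S c0" "c \<in> S" "c \<noteq> c0"
  shows "f c < f c0"
  using assms unfolding unique_maximizer_iff by (metis order_less_le order_trans)

lemma unique_maximizerI:
  assumes "c0 \<in> S" "\<And>c. c \<in> S \<Longrightarrow> c \<noteq> c0 \<Longrightarrow> f c < f c0"
  shows "unique_maximizer f S c0"
  using assms unfolding unique_maximizer_iff by (metis less_le_not_le order_refl)

subsection \<open>Sampling without replacement\<close>

lemma sum_nth_take:
  fixes q :: "'z \<Rightarrow> real"
  assumes "distinct zs" "i \<le> length zs"
  shows "(\<Sum>j<i. q (zs ! j)) = sum q (set (take i zs))"
proof -
  have "(\<Sum>j<i. q (zs ! j)) = sum_list (map q (take i zs))"
    using assms(2) by (simp add: sum_list_sum_nth atLeast0LessThan min_def)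
  also have "\<dots> = sum q (set (take i zs))"
    using assms(1) by (simp add: sum_list_distinct_conv_sum_set)
  finally show ?thesis .
qed

lemma prob_seq_norepl_distinct:
  assumes "distinct zs"
  shows "prob_seq_norepl q zs = (\<Prod>i<length zs. q (zs ! i) / (1 - sum q (set (take i zs))))"
  unfolding prob_seq_norepl_def by (rule prod.cong) (use assms in \<open>auto simp: sum_nth_take\<close>)

lemma prob_seq_norepl_snoc:
  assumes "distinct zs"
  shows "prob_seq_norepl q (zs @ [z]) = prob_seq_norepl q zs * (q z / (1 - sum q (set zs)))"
proof -
  have "(\<Sum>j<length zs. q ((zs @ [z]) ! j)) = (\<Sum>j<length zs. q (zs ! j))"
    by (simp add: nth_append)
  also have "\<dots> = sum q (set zs)" using sum_nth_take[OF assms, of "length zs" q] by simp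
  finally show ?thesis
    by (simp add: prob_seq_norepl_def nth_append)
qed

lemma prob_seq_norepl_nonneg:
  assumes "finite Z" "\<And>z. z \<in> Z \<Longrightarrow> q z \<ge> 0" "sum q Z \<le> 1" "distinct zs" "set zs \<subseteq> Z"
  shows "prob_seq_norepl q zs \<ge> 0"
  unfolding prob_seq_norepl_distinct[OF assms(4)]
proof (intro prod_nonneg ballI divide_nonneg_nonneg)
  fix i assume i: "i \<in> {..<length zs}"
  show "0 \<le> q (zs ! i)" using i assms(5) by (auto intro!: assms(2))
  have "set (take i zs) \<subseteq> Z" using assms(5) by (meson order_trans set_take_subset)
  then have "sum q (set (take i zs)) \<le> sum q Z" by (intro sum_mono2) (use assms in auto)
  then show "0 \<le> 1 - sum q (set (take i zs))" using assms(3) by simp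
qed

definition distinct_lists :: "'z set \<Rightarrow> nat \<Rightarrow> 'z list set" where
  "distinct_lists Z k = {zs. set zs \<subseteq> Z \<and> distinct zs \<and> length zs = k}"

lemma finite_distinct_lists: "finite Z \<Longrightarrow> finite (distinct_lists Z k)"
  unfolding distinct_lists_def
  by (rule finite_subset[OF _ finite_lists_length_eq[of Z k]]) auto

text \<open>Induction on the number of draws, splitting off the last one: the conditional
  probabilities of the last draw sum to 1. Equality is lost once the support is exhausted.\<close>

lemma sum_prob_seq_norepl_le_1:
  assumes "finite Z" "\<And>z. z \<in> Z \<Longrightarrow> q z \<ge> 0" "sum q Z = 1"
  shows "(\<Sum>zs\<in>distinct_lists Z k. prob_seq_norepl q zs) \<le> 1"
proof (induction k)
  case 0
  have "distinct_lists Z 0 = {[]}" by (auto simp: distinct_lists_def)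
  then show ?case by (simp add: prob_seq_norepl_def)
next
  case (Suc k)
  let ?D = "SIGMA zs:distinct_lists Z k. Z - set zs"
  have "bij_betw (\<lambda>(zs, z). zs @ [z]) ?D (distinct_lists Z (Suc k))"
  proof (rule bij_betw_imageI)
    show "inj_on (\<lambda>(zs, z). zs @ [z]) ?D" by (auto simp: inj_on_def)
    have "zs \<in> (\<lambda>(zs, z). zs @ [z]) ` ?D" if "zs \<in> distinct_lists Z (Suc k)" for zs
    proof -
      from that have "zs = butlast zs @ [last zs]"
        by (auto simp: distinct_lists_def intro!: append_butlast_last_id[symmetric])
      then obtain ys y where "zs = ys @ [y]" by blast
      with that show ?thesis
        by (auto simp: distinct_lists_def intro!: image_eqI[of _ _ "(ys, y)"])
    qed
    then show "(\<lambda>(zs, z). zs @ [z]) ` ?D = distinct_lists Z (Suc k)"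
      by (auto simp: distinct_lists_def)
  qed
  then have "(\<Sum>zs\<in>distinct_lists Z (Suc k). prob_seq_norepl q zs)
      = (\<Sum>(zs, z)\<in>?D. prob_seq_norepl q (zs @ [z]))"
    by (subst sum.reindex_bij_betw[symmetric]) (auto simp: case_prod_beta')
  also have "\<dots> = (\<Sum>zs\<in>distinct_lists Z k. \<Sum>z\<in>Z - set zs. prob_seq_norepl q (zs @ [z]))"
    using assms(1) by (intro sum.Sigma[symmetric]) (auto simp: finite_distinct_lists)
  also have "\<dots> \<le> (\<Sum>zs\<in>distinct_lists Z k. prob_seq_norepl q zs)"
  proof (rule sum_mono)
    fix zs assume zs: "zs \<in> distinct_lists Z k"
    then have d: "distinct zs" "set zs \<subseteq> Z" by (auto simp: distinct_lists_def)
    have nn: "prob_seq_norepl q zs \<ge> 0"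
      by (rule prob_seq_norepl_nonneg[OF assms(1,2)]) (use assms d in auto)
    have "(\<Sum>z\<in>Z - set zs. prob_seq_norepl q (zs @ [z]))
        = prob_seq_norepl q zs * (sum q (Z - set zs) / (1 - sum q (set zs)))"
      by (simp add: prob_seq_norepl_snoc[OF d(1)] sum_distrib_left sum_divide_distrib)
    also have "sum q (Z - set zs) = 1 - sum q (set zs)"
      using sum_diff[OF assms(1) d(2), of q] assms(3) by simp
    \<comment> \<open>The quotient is 1, or 0 if no mass remains, as division by zero yields
      0.\<close>
    also have "prob_seq_norepl q zs * ((1 - sum q (set zs)) / (1 - sum q (set zs))) \<le> prob_seq_norepl q zs"
      using nn by simp
    finally show "(\<Sum>z\<in>Z - set zs. prob_seq_norepl q (zs @ [z])) \<le> prob_seq_norepl q zs" .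
  qed
  also have "\<dots> \<le> 1" by (rule Suc)
  finally show ?case .
qed

lemma prob_seq_norepl_eq_0:
  assumes "z \<in> set zs" "q z = 0"
  shows "prob_seq_norepl q zs = 0"
  using assms by (auto simp: prob_seq_norepl_def in_set_conv_nth intro!: prod_zero)

lemma prob_set_norepl_eq_0:
  assumes "z \<in> A" "q z = 0"
  shows "prob_set_norepl q A = 0"
  unfolding prob_set_norepl_def
  by (rule sum.neutral) (use assms in \<open>auto dest: permutations_of_setD intro: prob_seq_norepl_eq_0\<close>)

lemma prob_set_norepl_nonneg:
  assumes "finite Z" "\<And>z. z \<in> Z \<Longrightarrow> q z \<ge> 0" "sum q Z \<le> 1" "A \<subseteq> Z"
  shows "prob_set_norepl q A \<ge> 0"
  unfolding prob_set_norepl_def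
  by (intro sum_nonneg prob_seq_norepl_nonneg[OF assms(1-3)])
     (use assms(4) in \<open>auto dest: permutations_of_setD\<close>)

text \<open>Positivity on all of \<open>S\<close> keeps every denominator of the formula without
  replacement positive, so probabilities can be compared factor by factor.\<close>

locale full_support =
  fixes q :: "'z \<Rightarrow> real" and S :: "'z set"
  assumes fin: "finite S"
    and pos: "\<And>z. z \<in> S \<Longrightarrow> q z > 0"
    and total: "sum q S = 1"
begin

text \<open>The element about to be drawn is still in the pool, so the remaining mass is at least
  its positive weight.\<close>

lemma remaining_ge:
  assumes "i < length zs" "distinct zs" "set zs \<subseteq> S"
  shows "q (zs ! i) \<le> 1 - sum q (set (take i zs))" "0 < 1 - sum q (set (take i zs))"
proof -
  have "sum q (set (take (Suc i) zs)) \<le> sum q S"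
    using assms set_take_subset[of "Suc i" zs] pos
    by (intro sum_mono2) (auto simp: fin intro: less_imp_le)
  moreover have "zs ! i \<notin> set (take i zs)"
    using assms by (auto simp: in_set_conv_nth nth_eq_iff_index_eq)
  ultimately show le: "q (zs ! i) \<le> 1 - sum q (set (take i zs))"
    using assms(1) by (simp add: take_Suc_conv_app_nth total)
  show "0 < 1 - sum q (set (take i zs))"
    using le pos[of "zs ! i"] nth_mem[OF assms(1)] assms(3) by auto
qed

lemma prob_seq_pos:
  assumes "distinct zs" "set zs \<subseteq> S"
  shows "prob_seq_norepl q zs > 0"
  unfolding prob_seq_norepl_distinct[OF assms(1)]
proof (rule prod_pos)
  fix i assume "i \<in> {..<length zs}"
  then show "0 < q (zs ! i) / (1 - sum q (set (take i zs)))"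
    using remaining_ge(2)[of i zs] pos[of "zs ! i"] nth_mem[of i zs] assms
    by (auto simp del: nth_mem)
qed

lemma prob_seq_nonneg: "distinct zs \<Longrightarrow> set zs \<subseteq> S \<Longrightarrow> prob_seq_norepl q zs \<ge> 0"
  using prob_seq_pos by (simp add: less_imp_le)

lemma prob_seq_sum_le_1:
  "(\<Sum>zs\<in>distinct_lists S k. prob_seq_norepl q zs) \<le> 1"
  by (rule sum_prob_seq_norepl_le_1) (auto simp: fin total intro: less_imp_le pos)

text \<open>If \<open>U\<close> contains \<open>z'\<close>, it contains \<open>z\<close> as well and
  the swap permutes \<open>U\<close>; otherwise the swap can only replace \<open>z\<close> by the
  element \<open>z'\<close>, which is at least as heavy.\<close>

lemma sum_transpose_ge:
  assumes "z' \<in> U \<Longrightarrow> z \<in> U" "q z \<le> q z'"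
  shows "sum q U \<le> sum (\<lambda>x. q (transpose z z' x)) U"
proof (cases "z' \<in> U")
  case True
  then have "transpose z z' ` U = U" using assms(1) by simp
  then have "sum q U = sum (\<lambda>x. q (transpose z z' x)) U"
    by (metis (mono_tags, lifting) inj_on_transpose sum.reindex_cong)
  then show ?thesis by simp
next
  case False
  then show ?thesis
    by (intro sum_mono) (use assms(2) in \<open>auto simp: transpose_def\<close>)
qed

text \<open>Moving a heavier element to an earlier draw increases every factor.\<close>

lemma prob_seq_transpose_ge:
  assumes zs: "distinct zs" "set zs \<subseteq> S" and i: "i < length zs"
    and z': "z' \<in> S" "z' \<notin> set (take (Suc i) zs)" "q (zs ! i) \<le> q z'"
  shows "prob_seq_norepl q zs \<le> prob_seq_norepl q (map (transpose (zs ! i) z') zs)"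
proof -
  define \<tau> where "\<tau> = transpose (zs ! i) z'"
  have iS: "zs ! i \<in> S" using i zs by auto
  have \<tau>S: "\<tau> x \<in> S" if "x \<in> S" for x
    using that iS z' by (auto simp: \<tau>_def transpose_def)
  have inj: "inj_on \<tau> A" for A by (simp add: \<tau>_def)
  have d': "distinct (map \<tau> zs)" "set (map \<tau> zs) \<subseteq> S"
    using zs inj \<tau>S by (auto simp: distinct_map)
  \<comment> \<open>Since \<open>z'\<close> is not among the first \<open>i + 1\<close> draws, a
    prefix that contains it also contains \<open>zs ! i\<close>. So the swap never lowers the mass
    drawn so far, and no denominator grows.\<close>
  have prefix: "sum q (set (take j zs)) \<le> sum q (set (take j (map \<tau> zs)))" if "j < length zs" for j
  proof -
    have "zs ! i \<in> set (take j zs)" if "z' \<in> set (take j zs)"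
    proof -
      have "\<not> j \<le> Suc i"
        using that z'(2) set_take_subset_set_take[of j "Suc i" zs] by auto
      then show ?thesis using i by (auto simp: in_set_conv_nth intro!: exI[of _ i])
    qed
    then have "sum q (set (take j zs)) \<le> sum (\<lambda>x. q (\<tau> x)) (set (take j zs))"
      unfolding \<tau>_def by (rule sum_transpose_ge) (use z' in auto)
    also have "\<dots> = sum q (\<tau> ` set (take j zs))"
      by (simp add: sum.reindex[OF inj])
    finally show ?thesis by (simp add: take_map)
  qed
  \<comment> \<open>If \<open>z'\<close> is drawn later, the swap permutes the drawn elements and
    keeps the product; otherwise it replaces one factor by one at least as large.\<close>
  have num: "(\<Prod>j<length zs. q (zs ! j)) \<le> (\<Prod>j<length zs. q (\<tau> (zs ! j)))"
  proof (cases "z' \<in> set zs")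
    case True
    then have im: "\<tau> ` set zs = set zs" using i by (simp add: \<tau>_def)
    have eq: "(\<Prod>j<length zs. f (zs ! j)) = prod f (set zs)" for f :: "'z \<Rightarrow> real"
      by (rule prod.reindex_bij_betw[OF bij_betw_nth]) (use zs in auto)
    have "prod q (set zs) = prod (\<lambda>x. q (\<tau> x)) (set zs)"
      using prod.reindex[OF inj[of "set zs"], of q] im by simp
    then show ?thesis using eq[of q] eq[of "\<lambda>x. q (\<tau> x)"] by simp
  next
    case False
    have "q (zs ! j) \<le> q (\<tau> (zs ! j))" if "j < length zs" for j
      using that z'(3) False by (auto simp: \<tau>_def transpose_def)
    then show ?thesis
      using zs pos by (intro prod_mono) (auto simp: less_imp_le subset_iff)
  qed
  have "(\<Prod>j<length zs. q (zs ! j)) / (\<Prod>j<length zs. 1 - sum q (set (take j zs)))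
     \<le> (\<Prod>j<length zs. q (\<tau> (zs ! j))) / (\<Prod>j<length zs. 1 - sum q (set (take j (map \<tau> zs))))"
  proof (rule frac_le[OF _ num])
    show "0 \<le> (\<Prod>j<length zs. q (\<tau> (zs ! j)))"
      using zs \<tau>S pos by (intro prod_nonneg) (auto simp: less_imp_le subset_iff)
    show "0 < (\<Prod>j<length zs. 1 - sum q (set (take j (map \<tau> zs))))"
      using remaining_ge(2)[of _ "map \<tau> zs"] d' by (intro prod_pos) auto
    show "(\<Prod>j<length zs. 1 - sum q (set (take j (map \<tau> zs))))
        \<le> (\<Prod>j<length zs. 1 - sum q (set (take j zs)))"
    proof (intro prod_mono conjI)
      fix j assume j: "j \<in> {..<length zs}"
      then show "0 \<le> 1 - sum q (set (take j (map \<tau> zs)))"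
        using remaining_ge(2)[of j "map \<tau> zs"] d' by simp
      show "1 - sum q (set (take j (map \<tau> zs))) \<le> 1 - sum q (set (take j zs))"
        using prefix j by simp
    qed
  qed
  then show ?thesis
    unfolding \<tau>_def[symmetric] prob_seq_norepl_distinct[OF zs(1)] prob_seq_norepl_distinct[OF d'(1)]
    by (simp add: prod_dividef)
qed

text \<open>The sequence and its swapped image are two distinct outcomes of the same number of
  draws, and the image is at least as likely.\<close>

lemma prob_seq_le_half:
  assumes zs: "distinct zs" "set zs \<subseteq> S" and i: "i < length zs"
    and z': "z' \<in> S" "z' \<notin> set (take (Suc i) zs)" "q (zs ! i) \<le> q z'"
  shows "prob_seq_norepl q zs \<le> 1 / 2"
proof -
  let ?zs' = "map (transpose (zs ! i) z') zs"
  have "set ?zs' \<subseteq> S" using assms by (auto simp: transpose_def)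
  moreover have "distinct ?zs'" using zs by (simp add: distinct_map)
  ultimately have mem: "{zs, ?zs'} \<subseteq> distinct_lists S (length zs)"
    using zs by (auto simp: distinct_lists_def)
  have "?zs' ! i = z'" using i by simp
  moreover have "zs ! i \<noteq> z'" using z'(2) i by (auto simp: take_Suc_conv_app_nth)
  ultimately have "zs \<noteq> ?zs'" by metis
  then have "prob_seq_norepl q zs + prob_seq_norepl q ?zs' = sum (prob_seq_norepl q) {zs, ?zs'}"
    by simp
  also have "\<dots> \<le> (\<Sum>zs\<in>distinct_lists S (length zs). prob_seq_norepl q zs)"
    by (rule sum_mono2[OF _ mem]) (auto simp: distinct_lists_def prob_seq_nonneg intro: finite_distinct_lists[OF fin, unfolded distinct_lists_def])
  also have "\<dots> \<le> 1" by (rule prob_seq_sum_le_1)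
  finally show ?thesis using prob_seq_transpose_ge[OF assms] by simp
qed

text \<open>The swap carries the enumerations of \<open>A\<close> bijectively to those of
  \<open>A'\<close> and never lowers a probability. As \<open>A\<close> lacks \<open>z'\<close>, the
  two families of enumerations are disjoint and share a total mass of at most 1.\<close>

lemma prob_set_le_half:
  assumes A: "A \<subseteq> S" and z: "z \<in> A" and z': "z' \<in> S - A" "q z \<le> q z'"
  shows "prob_set_norepl q A \<le> 1 / 2"
proof -
  define \<tau> where "\<tau> = transpose z z'"
  define A' where "A' = \<tau> ` A"
  have fA: "finite A" using A fin finite_subset by auto
  have neq: "z \<noteq> z'" using z z' by auto
  have zA': "z' \<in> A'" using z by (auto simp: A'_def \<tau>_def image_iff intro!: bexI[of _ z])
  have A'S: "A' \<subseteq> S" using A z z' by (auto simp: A'_def \<tau>_def transpose_def)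
  have cA': "card A' = card A" unfolding A'_def by (rule card_image) (simp add: \<tau>_def)
  have fA': "finite A'" using fA by (simp add: A'_def)
  have perms: "permutations_of_set B \<subseteq> distinct_lists S (card B)" if "B \<subseteq> S" for B
    using that by (auto simp: distinct_lists_def dest: permutations_of_setD
      length_finite_permutations_of_set)
  have "prob_set_norepl q A \<le> (\<Sum>zs\<in>permutations_of_set A. prob_seq_norepl q (map \<tau> zs))"
    unfolding prob_set_norepl_def
  proof (rule sum_mono)
    fix zs assume "zs \<in> permutations_of_set A"
    then have zs: "set zs = A" "distinct zs" by (auto dest: permutations_of_setD)
    obtain i where i: "i < length zs" "zs ! i = z" using z zs by (metis in_set_conv_nth)
    show "prob_seq_norepl q zs \<le> prob_seq_norepl q (map \<tau> zs)"
      using prob_seq_transpose_ge[of zs i z'] zs i A z' set_take_subset[of "Suc i" zs]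
      by (auto simp: \<tau>_def)
  qed
  also have "\<dots> = prob_set_norepl q A'"
    unfolding prob_set_norepl_def A'_def
    by (subst permutations_of_set_image_inj)
       (auto simp: \<tau>_def sum.reindex inj_on_mapI)
  finally have le: "prob_set_norepl q A \<le> prob_set_norepl q A'" .
  have "prob_set_norepl q A + prob_set_norepl q A'
      = (\<Sum>zs\<in>permutations_of_set A \<union> permutations_of_set A'. prob_seq_norepl q zs)"
    unfolding prob_set_norepl_def using zA' z'
    by (intro sum.union_disjoint[symmetric]) (auto dest: permutations_of_setD)
  also have "\<dots> \<le> (\<Sum>zs\<in>distinct_lists S (card A). prob_seq_norepl q zs)"
    using perms[OF A] perms[OF A'S] cA'
    by (intro sum_mono2) (auto simp: distinct_lists_def prob_seq_nonneg intro: finite_distinct_lists[OF fin, unfolded distinct_lists_def])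
  also have "\<dots> \<le> 1" by (rule prob_seq_sum_le_1)
  finally show ?thesis using le by simp
qed

end

subsection \<open>Likelihoods concentrated on a given sample\<close>

definition normalize_on :: "('z \<Rightarrow> real) \<Rightarrow> 'z set \<Rightarrow> 'z \<Rightarrow> real" where
  "normalize_on w S z = (if z \<in> S then w z / sum w S else 0)"

locale weights =
  fixes w :: "'z \<Rightarrow> real" and S :: "'z set"
  assumes fin: "finite S" and ne: "S \<noteq> {}" and w_pos: "\<And>z. z \<in> S \<Longrightarrow> w z > 0"
begin

lemma sum_pos: "sum w S > 0"
  using fin ne w_pos by (simp add: sum_pos)

sublocale full_support "normalize_on w S" S
  by unfold_locales
     (use fin w_pos sum_pos in \<open>auto simp: normalize_on_def sum_divide_distrib[symmetric]\<close>)

text \<open>The normalizing constant cancels, so draws without replacement can be computed with the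
  raw weights.\<close>

lemma conditional_prob:
  assumes "z \<in> S" "U \<subseteq> S"
  shows "normalize_on w S z / (1 - sum (normalize_on w S) U) = w z / sum w (S - U)"
proof -
  have "sum (normalize_on w S) U = sum w U / sum w S"
    using assms(2) by (subst sum_divide_distrib) (auto simp: normalize_on_def intro!: sum.cong)
  then have "1 - sum (normalize_on w S) U = sum w (S - U) / sum w S"
    using sum_pos sum_diff[OF fin assms(2), of w] by (simp add: field_simps)
  then show ?thesis using assms(1) sum_pos by (simp add: normalize_on_def)
qed

lemma prob_seq_weights:
  assumes "distinct zs" "set zs \<subseteq> S"
  shows "prob_seq_norepl (normalize_on w S) zs = (\<Prod>i<length zs. w (zs ! i) / sum w (S - set (take i zs)))"
  unfolding prob_seq_norepl_distinct[OF assms(1)]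
proof (rule prod.cong[OF refl])
  fix i assume "i \<in> {..<length zs}"
  then have "zs ! i \<in> S" "set (take i zs) \<subseteq> S"
    using assms(2) set_take_subset[of i zs] nth_mem[of i zs] by (auto simp del: nth_mem)
  then show "normalize_on w S (zs ! i) / (1 - sum (normalize_on w S) (set (take i zs)))
      = w (zs ! i) / sum w (S - set (take i zs))" by (rule conditional_prob)
qed

end

text \<open>Here \<open>m\<close> is the number of consistent examples of a concept. At most
  \<open>m\<close> draws, each competing with at most \<open>m\<close> light elements, cost at most
  \<open>m^2 * small m = 1/4\<close> of the probability.\<close>

definition small :: "nat \<Rightarrow> real" where
  "small m = 1 / (4 * real m ^ 2)"

lemma small_bounds:
  assumes "m > 0"
  shows "0 < small m" "small m < 1"
proof -
  have "real m ^ 2 \<ge> 1" using assms by simp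
  then have "1 < 4 * real m ^ 2" by linarith
  then show "0 < small m" "small m < 1" using assms by (simp_all add: small_def)
qed

text \<open>With \<open>x = m * small m\<close>, the bound \<open>1 - x <= 1 / (1 + x)\<close> and
  Bernoulli's inequality give at least \<open>1 - m * x = 3/4\<close>.\<close>

lemma small_power:
  assumes "m > 0" "k \<le> m"
  shows "1 / 2 < (1 / (1 + real m * small m)) ^ k"
proof -
  define x where "x = 1 / (4 * real m)"
  have ms: "real m * small m = x" using assms by (simp add: small_def x_def power2_eq_square)
  have x: "0 < x" "x < 1" "real m * x = 1 / 4" using assms by (auto simp: x_def)
  have "1 / 2 < 1 + real m * (- x)" using x by simp
  also have "\<dots> \<le> (1 + (- x)) ^ m" by (rule Bernoulli_inequality) (use x in simp)
  also have "\<dots> \<le> (1 / (1 + x)) ^ m"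
  proof (rule power_mono)
    have "(1 + (- x)) * (1 + x) \<le> 1" by (simp add: algebra_simps)
    then show "1 + (- x) \<le> 1 / (1 + x)" using x by (simp add: field_simps)
  qed (use x in simp)
  also have "\<dots> \<le> (1 / (1 + x)) ^ k"
    by (rule power_decreasing) (use assms x in auto)
  finally show ?thesis by (simp add: ms)
qed

section \<open>Weights concentrated on a set\<close>

definition set_weight :: "nat \<Rightarrow> 'z set \<Rightarrow> 'z \<Rightarrow> real" where
  "set_weight m B z = (if z \<in> B then 1 else small m)"

lemma set_weight_pos: "m > 0 \<Longrightarrow> set_weight m B z > 0"
  by (simp add: set_weight_def small_bounds)

text \<open>After \<open>i\<close> draws from \<open>B\<close>, there remain \<open>b - i\<close>
  elements of weight 1 and light elements of total weight at most \<open>m * small m\<close>. So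
  every enumeration of \<open>B\<close> has probability at least \<open>r ^ b / b!\<close>, and
  there are \<open>b!\<close> of them.\<close>

lemma prob_set_own_gt_half:
  assumes S: "finite S" "S \<noteq> {}" "card S = m" and B: "B \<subseteq> S"
  shows "1 / 2 < prob_set_norepl (normalize_on (set_weight m B) S) B"
proof -
  have m: "m > 0" using S by (auto simp: card_gt_0_iff)
  interpret weights "set_weight m B" S
    by unfold_locales (use S m in \<open>auto simp: set_weight_pos\<close>)
  have fB: "finite B" using B S finite_subset by auto
  define b where "b = card B"
  define r where "r = 1 / (1 + real m * small m)"
  have r0: "r > 0" using small_bounds(1)[OF m] by (simp add: r_def add_pos_nonneg)
  have "r ^ b / fact b \<le> prob_seq_norepl (normalize_on (set_weight m B) S) zs"
    if "zs \<in> permutations_of_set B" for zs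
  proof -
    have zs: "set zs = B" "distinct zs" "length zs = b"
      using that fB by (auto dest: permutations_of_setD simp: length_finite_permutations_of_set b_def)
    have "r ^ b / fact b = (\<Prod>i<b. r / real (b - i))"
      by (simp add: prod_dividef fact_prod_rev atLeast0LessThan)
    also have "\<dots> \<le> (\<Prod>i<b. set_weight m B (zs ! i) / sum (set_weight m B) (S - set (take i zs)))"
    proof (intro prod_mono conjI)
      fix i assume "i \<in> {..<b}"
      then have i: "i < b" by simp
      show "0 \<le> r / real (b - i)" using r0 by simp
      have sub: "set (take i zs) \<subseteq> B" using set_take_subset[of i zs] zs by simp
      have "card (set (take i zs)) = i"
        using zs i by (simp add: distinct_card)
      then have cB: "card (B - set (take i zs)) = b - i"
        using sub by (simp add: card_Diff_subset b_def)
      have "S - set (take i zs) = (B - set (take i zs)) \<union> (S - B)"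
        using sub B by auto
      then have "sum (set_weight m B) (S - set (take i zs))
          = sum (set_weight m B) (B - set (take i zs)) + sum (set_weight m B) (S - B)"
        using S fB by (simp add: sum.union_disjoint Diff_Int_distrib2 Int_Diff)
      also have "sum (set_weight m B) (B - set (take i zs)) = real (b - i)"
        using cB by (simp add: set_weight_def)
      also have "sum (set_weight m B) (S - B) = real (card (S - B)) * small m"
        by (simp add: set_weight_def)
      also have "\<dots> \<le> real m * small m"
        using S card_mono[OF S(1), of "S - B"] small_bounds(1)[OF m] by (intro mult_right_mono) auto
      \<comment> \<open>As \<open>b - i\<close> is at least 1, the light mass may be scaled by it;
        this brings the bound into the form \<open>(b - i) / r\<close>.\<close>
      also have "real (b - i) + real m * small m \<le> real (b - i) * (1 + real m * small m)"
      proof -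
        have "1 * (real m * small m) \<le> real (b - i) * (real m * small m)"
          using i small_bounds(1)[OF m] by (intro mult_right_mono) auto
        then show ?thesis by (simp add: distrib_left)
      qed
      finally have le: "sum (set_weight m B) (S - set (take i zs)) \<le> real (b - i) * (1 + real m * small m)"
        by simp
      have zi: "zs ! i \<in> B" using zs i by auto
      have "zs ! i \<notin> set (take i zs)"
        using zs i by (auto simp: in_set_conv_nth nth_eq_iff_index_eq)
      then have gt: "0 < sum (set_weight m B) (S - set (take i zs))"
        using zi B S m by (intro sum_pos2[of _ "zs ! i"]) (auto simp: set_weight_pos less_imp_le)
      have "r / real (b - i) = 1 / (real (b - i) * (1 + real m * small m))"
        by (simp add: r_def)
      also have "\<dots> \<le> 1 / sum (set_weight m B) (S - set (take i zs))"
        by (intro frac_le le gt) auto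
      finally show "r / real (b - i) \<le> set_weight m B (zs ! i) / sum (set_weight m B) (S - set (take i zs))"
        using zi by (simp add: set_weight_def)
    qed
    also have "\<dots> = prob_seq_norepl (normalize_on (set_weight m B) S) zs"
      using prob_seq_weights[of zs] zs B by simp
    finally show ?thesis .
  qed
  then have "(\<Sum>zs\<in>permutations_of_set B. r ^ b / fact b) \<le> prob_set_norepl (normalize_on (set_weight m B) S) B"
    unfolding prob_set_norepl_def by (rule sum_mono)
  then have "r ^ b \<le> prob_set_norepl (normalize_on (set_weight m B) S) B"
    using fB by (simp add: b_def)
  moreover have "b \<le> m" using B S by (auto simp: b_def intro: card_mono)
  ultimately show ?thesis using small_power[OF m, of b] by (simp add: r_def)
qed

text \<open>Some example missing from \<open>A\<close> is at least as heavy as one in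
  \<open>A\<close>: an element of \<open>B - A\<close> if \<open>A\<close> lies inside
  \<open>B\<close>, and any missing element if \<open>A\<close> contains a light one. Then
  \<open>prob_set_le_half\<close> applies.\<close>

lemma prob_set_other_le_half:
  assumes S: "finite S" "S \<noteq> {}" "card S = m" and B: "B \<subseteq> S"
    and A: "A \<noteq> {}" "A \<noteq> B" "A \<noteq> S"
  shows "prob_set_norepl (normalize_on (set_weight m B) S) A \<le> 1 / 2"
proof (cases "A \<subseteq> S")
  case False
  then obtain z where "z \<in> A" "z \<notin> S" by auto
  then show ?thesis by (simp add: prob_set_norepl_eq_0[of z] normalize_on_def)
next
  case True
  have m: "m > 0" using S by (auto simp: card_gt_0_iff)
  interpret weights "set_weight m B" S
    by unfold_locales (use S m in \<open>auto simp: set_weight_pos\<close>)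
  have "\<exists>z\<in>A. \<exists>z'\<in>S - A. set_weight m B z \<le> set_weight m B z'"
  proof (cases "A \<subseteq> B")
    case True
    then show ?thesis using A B by (force simp: set_weight_def)
  next
    case False
    then obtain z where "z \<in> A" "z \<notin> B" by auto
    moreover obtain z' where "z' \<in> S - A" using \<open>A \<subseteq> S\<close> A by auto
    ultimately show ?thesis using small_bounds[OF m] by (force simp: set_weight_def less_imp_le)
  qed
  then obtain z z' where z: "z \<in> A" "z' \<in> S - A" "set_weight m B z \<le> set_weight m B z'" by blast
  have "normalize_on (set_weight m B) S z \<le> normalize_on (set_weight m B) S z'"
    using z \<open>A \<subseteq> S\<close> sum_pos by (auto simp: normalize_on_def divide_right_mono)
  then show ?thesis using prob_set_le_half[OF True z(1,2)] by simp
qed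

section \<open>Weights decreasing along a sequence\<close>

definition seq_weight :: "nat \<Rightarrow> 'z list \<Rightarrow> 'z \<Rightarrow> real" where
  "seq_weight m s z =
     small m ^ (if z \<in> set s then length (takeWhile (\<lambda>x. x \<noteq> z) s) else m)"

lemma seq_weight_pos: "m > 0 \<Longrightarrow> seq_weight m s z > 0"
  by (simp add: seq_weight_def small_bounds)

lemma seq_weight_nth:
  assumes "distinct s" "i < length s"
  shows "seq_weight m s (s ! i) = small m ^ i"
proof -
  have "takeWhile (\<lambda>x. x \<noteq> s ! i) s = take i s"
    using assms by (intro takeWhile_eq_take_P_nth) (auto simp: nth_eq_iff_index_eq)
  then show ?thesis using assms by (simp add: seq_weight_def)
qed

text \<open>Positions in a repetition-free \<open>s\<close> over an \<open>m\<close>-element set are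
  below \<open>m\<close>, so the exponent \<open>m\<close> makes all other elements lighter than
  every entry of \<open>s\<close>.\<close>

lemma seq_weight_rest: "z \<notin> set s \<Longrightarrow> seq_weight m s z = small m ^ m"
  by (simp add: seq_weight_def)

lemma small_power_le: "m > 0 \<Longrightarrow> i \<le> j \<Longrightarrow> small m ^ j \<le> small m ^ i"
  using small_bounds[of m] by (intro power_decreasing) auto

lemma small_power_less: "m > 0 \<Longrightarrow> i < j \<Longrightarrow> small m ^ j < small m ^ i"
  using small_bounds[of m] by (intro power_strict_decreasing) auto

text \<open>At draw \<open>i\<close> each competitor of \<open>s ! i\<close> weighs at most
  \<open>small m\<close> times as much, and there are at most \<open>m\<close> of them. Hence each
  factor is at least \<open>r\<close>.\<close>

lemma prob_seq_own_gt_half: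
  assumes S: "finite S" "S \<noteq> {}" "card S = m" and s: "set s \<subseteq> S" "distinct s"
  shows "1 / 2 < prob_seq_norepl (normalize_on (seq_weight m s) S) s"
proof -
  have m: "m > 0" using S by (auto simp: card_gt_0_iff)
  interpret weights "seq_weight m s" S
    by unfold_locales (use S m in \<open>auto simp: seq_weight_pos\<close>)
  define r where "r = 1 / (1 + real m * small m)"
  have r0: "r > 0" using small_bounds(1)[OF m] by (simp add: r_def add_pos_nonneg)
  have km: "length s \<le> m" using S s card_mono[OF S(1) s(1)] by (simp add: distinct_card)
  have "r ^ length s = (\<Prod>i<length s. r)" by simp
  also have "\<dots> \<le> (\<Prod>i<length s. seq_weight m s (s ! i) / sum (seq_weight m s) (S - set (take i s)))"
  proof (intro prod_mono conjI)
    fix i assume "i \<in> {..<length s}"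
    then have i: "i < length s" by simp
    show "0 \<le> r" using r0 by simp
    have si: "s ! i \<in> S" "s ! i \<notin> set (take i s)"
      using s(1) nth_mem[OF i] s(2) i by (blast, auto simp: in_set_conv_nth nth_eq_iff_index_eq)
    define R where "R = S - set (take (Suc i) s)"
    have eq: "S - set (take i s) = insert (s ! i) R" "s ! i \<notin> R"
      using si i by (auto simp: R_def take_Suc_conv_app_nth)
    have "seq_weight m s z \<le> small m ^ Suc i" if "z \<in> R" for z
    proof (cases "z \<in> set s")
      case True
      then obtain j where j: "j < length s" "z = s ! j" by (auto simp: in_set_conv_nth)
      have "\<not> j < Suc i"
        using that j by (auto simp: R_def in_set_conv_nth)
      then show ?thesis using j s small_power_le[OF m, of "Suc i" j] by (simp add: seq_weight_nth)
    next
      case False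
      then show ?thesis using i km small_power_le[OF m, of "Suc i" m] by (simp add: seq_weight_rest)
    qed
    then have "sum (seq_weight m s) R \<le> real (card R) * small m ^ Suc i"
      by (rule sum_bounded_above)
    also have "\<dots> \<le> real m * small m ^ Suc i"
      using S card_mono[OF S(1), of R] small_bounds(1)[OF m]
      by (intro mult_right_mono) (auto simp: R_def)
    finally have le: "sum (seq_weight m s) (S - set (take i s)) \<le> small m ^ i * (1 + real m * small m)"
      using S(1) eq(2) i s unfolding eq(1)
      by (subst sum.insert) (auto simp: R_def seq_weight_nth algebra_simps)
    have gt: "0 < sum (seq_weight m s) (S - set (take i s))"
      using si S m by (intro sum_pos2[of _ "s ! i"]) (auto simp: seq_weight_pos less_imp_le)
    have "r = small m ^ i / (small m ^ i * (1 + real m * small m))"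
      using small_bounds(1)[OF m] by (simp add: r_def)
    also have "\<dots> \<le> small m ^ i / sum (seq_weight m s) (S - set (take i s))"
      using le gt small_bounds(1)[OF m]
      by (intro frac_le) auto
    finally show "r \<le> seq_weight m s (s ! i) / sum (seq_weight m s) (S - set (take i s))"
      using i s by (simp add: seq_weight_nth)
  qed
  also have "\<dots> = prob_seq_norepl (normalize_on (seq_weight m s) S) s"
    using prob_seq_weights[of s] s by simp
  finally show ?thesis using small_power[OF m km] by (simp add: r_def)
qed

text \<open>A probability above 1/2 would force \<open>t\<close> to draw by decreasing weight, by
  \<open>prob_seq_le_half\<close>, and hence to be a prefix of \<open>s\<close>. Prefixes are
  excluded because they are likely as well.\<close>

lemma prob_seq_other_le_half:
  assumes S: "finite S" "S \<noteq> {}" "card S = m" and s: "set s \<subseteq> S" "distinct s"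
    and t: "distinct t" "set t \<noteq> S" "t \<noteq> take (length t) s"
  shows "prob_seq_norepl (normalize_on (seq_weight m s) S) t \<le> 1 / 2"
proof (cases "set t \<subseteq> S")
  case False
  then obtain z where "z \<in> set t" "z \<notin> S" by auto
  then show ?thesis by (simp add: prob_seq_norepl_eq_0[of z] normalize_on_def)
next
  case True
  have m: "m > 0" using S by (auto simp: card_gt_0_iff)
  interpret weights "seq_weight m s" S
    by unfold_locales (use S m in \<open>auto simp: seq_weight_pos\<close>)
  have km: "length s \<le> m" using S s card_mono[OF S(1) s(1)] by (simp add: distinct_card)
  show ?thesis
  proof (rule ccontr)
    assume gt: "\<not> ?thesis"
    have sorted: "z' \<in> set (take (Suc i) t)"
      if "i < length t" "z' \<in> S" "seq_weight m s (t ! i) \<le> seq_weight m s z'" for i z'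
    proof (rule ccontr)
      assume "z' \<notin> set (take (Suc i) t)"
      moreover have "t ! i \<in> S" using that True by auto
      then have "normalize_on (seq_weight m s) S (t ! i) \<le> normalize_on (seq_weight m s) S z'"
        using that sum_pos by (auto simp: normalize_on_def divide_right_mono)
      ultimately show False
        using prob_seq_le_half[OF t(1) True that(1,2)] gt by simp
    qed
    have weight_ge: "small m ^ m \<le> seq_weight m s z" for z
    proof (cases "z \<in> set s")
      case True
      then obtain j where "j < length s" "z = s ! j" by (auto simp: in_set_conv_nth)
      then show ?thesis using s km small_power_le[OF m, of j m] by (simp add: seq_weight_nth)
    qed (simp add: seq_weight_rest)
    \<comment> \<open>An entry outside \<open>s\<close> has minimal weight, so all of
      \<open>S\<close> would have to be drawn by then.\<close>
    have in_s: "t ! i \<in> set s" if i: "i < length t" for i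
    proof (rule ccontr)
      assume "t ! i \<notin> set s"
      then have "S \<subseteq> set (take (Suc i) t)"
        using sorted[OF i] weight_ge by (auto simp: seq_weight_rest)
      then have "S \<subseteq> set t" by (meson order_trans set_take_subset)
      then show False using t(2) True by simp
    qed
    have "i \<le> length s \<and> take i t = take i s" if "i \<le> length t" for i
      using that
    proof (induction i)
      case (Suc i)
      then have i: "i < length t" and le: "i \<le> length s" and IH: "take i t = take i s" by auto
      obtain j where j: "j < length s" "t ! i = s ! j"
        using in_s[OF i] by (auto simp: in_set_conv_nth)
      have "t ! i \<notin> set (take i s)"
        using t(1) i unfolding IH[symmetric] by (auto simp: in_set_conv_nth nth_eq_iff_index_eq)
      then have "i \<le> j" using j by (metis in_set_conv_nth length_take min_less_iff_conj not_less nth_take)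
      then have il: "i < length s" using j by simp
      \<comment> \<open>Being at least as heavy as \<open>t ! i = s ! j\<close>, the element
        \<open>s ! i\<close> is among the first \<open>i + 1\<close> draws; the first
        \<open>i\<close> draws are earlier entries of \<open>s\<close>, so it is
        \<open>t ! i\<close>.\<close>
      have "s ! i \<in> set (take (Suc i) t)"
      proof (rule sorted[OF i])
        show "s ! i \<in> S" using il s by auto
        show "seq_weight m s (t ! i) \<le> seq_weight m s (s ! i)"
          using j il s \<open>i \<le> j\<close> small_power_le[OF m, of i j] by (simp add: seq_weight_nth)
      qed
      moreover have "s ! i \<notin> set (take i s)"
        using s il by (auto simp: in_set_conv_nth nth_eq_iff_index_eq)
      ultimately have "s ! i = t ! i"
        using i IH by (simp add: take_Suc_conv_app_nth)
      then show ?case using i il IH by (simp add: take_Suc_conv_app_nth)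
    qed simp
    from this[of "length t"] show False using t(3) by simp
  qed
qed

text \<open>The total depends on \<open>S\<close> and \<open>s\<close> only through \<open>m\<close>
  and \<open>length s\<close>, so totals over the example sets of two concepts can be compared
  termwise.\<close>

lemma sum_seq_weight:
  assumes S: "finite S" "card S = m" and s: "set s \<subseteq> S" "distinct s"
  shows "sum (seq_weight m s) S = (\<Sum>i<m. if i < length s then small m ^ i else small m ^ m)"
proof -
  have km: "length s \<le> m" using S s card_mono[OF S(1) s(1)] by (simp add: distinct_card)
  have "sum (seq_weight m s) S = sum (seq_weight m s) (set s) + sum (seq_weight m s) (S - set s)"
    using S s by (simp add: sum.subset_diff)
  also have "sum (seq_weight m s) (set s) = (\<Sum>i<length s. seq_weight m s (s ! i))"
    by (rule sum.reindex_bij_betw[OF bij_betw_nth, symmetric]) (use s in auto)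
  also have "\<dots> = (\<Sum>i<length s. if i < length s then small m ^ i else small m ^ m)"
    using s by (intro sum.cong) (auto simp: seq_weight_nth)
  also have "sum (seq_weight m s) (S - set s) = real (m - length s) * small m ^ m"
    using S s by (simp add: seq_weight_rest card_Diff_subset distinct_card)
  also have "\<dots> = (\<Sum>i=length s..<m. if i < length s then small m ^ i else small m ^ m)"
    by simp
  also have "(\<Sum>i<length s. if i < length s then small m ^ i else small m ^ m) + \<dots>
      = (\<Sum>i<m. if i < length s then small m ^ i else small m ^ m)"
    unfolding atLeast0LessThan[symmetric] by (rule sum.atLeastLessThan_concat[OF _ km]) simp
  finally show ?thesis .
qed

text \<open>A sequence and a proper extension of it give the same weights to the common prefix;
  the extension has the larger total weight.\<close>

lemma prob_seq_prefix_less: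
  assumes S: "finite S" "card S = m" "finite S'" "card S' = m" "m > 0"
    and s: "set s \<subseteq> S" "distinct s" "length t < length s"
    and t: "set t \<subseteq> S'" "t = take (length t) s" "t \<noteq> []"
  shows "prob_seq_norepl (normalize_on (seq_weight m s) S) t
    < prob_seq_norepl (normalize_on (seq_weight m t) S') t"
proof -
  have ne: "S \<noteq> {}" "S' \<noteq> {}" using S by auto
  interpret weights "seq_weight m s" S
    by unfold_locales (use S ne in \<open>auto simp: seq_weight_pos\<close>)
  interpret t: weights "seq_weight m t" S'
    by unfold_locales (use S ne in \<open>auto simp: seq_weight_pos\<close>)
  have dt: "distinct t" using s t(2) by (metis distinct_take)
  have tS: "set t \<subseteq> S" using s(1) t(2) by (metis order_trans set_take_subset)
  have nth: "t ! i = s ! i" if "i < length t" for i using t(2) that by (metis nth_take)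
  have same: "seq_weight m s z = seq_weight m t z" if z: "z \<in> set t" for z
  proof -
    obtain i where i: "i < length t" "t ! i = z" using z by (metis in_set_conv_nth)
    then have "s ! i = z" using nth by simp
    then show ?thesis
      using i s seq_weight_nth[OF dt i(1), of m] seq_weight_nth[OF s(2), of i m] by simp
  qed
  have km: "length s \<le> m" using S s card_mono[OF S(1) s(1)] by (simp add: distinct_card)
  \<comment> \<open>At index \<open>length t\<close> the longer sequence contributes
    \<open>small m ^ length t\<close>, the shorter one only \<open>small m ^ m\<close>.\<close>
  have W: "sum (seq_weight m t) S' < sum (seq_weight m s) S"
    unfolding sum_seq_weight[OF S(1,2) s(1,2)] sum_seq_weight[OF S(3,4) t(1) dt]
  proof (rule sum_strict_mono_ex1)
    show "\<exists>i\<in>{..<m}. (if i < length t then small m ^ i else small m ^ m)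
        < (if i < length s then small m ^ i else small m ^ m)"
      using s km S(5) by (intro bexI[of _ "length t"]) (auto simp: small_power_less)
  qed (use s S(5) small_power_le[of m] in \<open>auto simp: less_imp_le\<close>)
  have factor: "0 \<le> seq_weight m s (t ! i) / sum (seq_weight m s) (S - set (take i t))"
    "seq_weight m s (t ! i) / sum (seq_weight m s) (S - set (take i t))
      < seq_weight m t (t ! i) / sum (seq_weight m t) (S' - set (take i t))"
    if i: "i < length t" for i
  proof -
    define U where "U = set (take i t)"
    have U: "U \<subseteq> set t" by (simp add: U_def set_take_subset)
    then have US: "U \<subseteq> S" "U \<subseteq> S'" using tS t(1) by auto
    have "t ! i \<notin> U"
      unfolding U_def using dt i by (auto simp: in_set_conv_nth nth_eq_iff_index_eq)
    then have gt: "0 < sum (seq_weight m t) (S' - U)"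
      using i t(1) S by (intro sum_pos2[of _ "t ! i"]) (auto simp: seq_weight_pos less_imp_le)
    \<comment> \<open>The elements already drawn weigh the same under both, so the gap between the
      totals passes to the remaining masses.\<close>
    have "sum (seq_weight m s) U = sum (seq_weight m t) U"
      using U same by (intro sum.cong) auto
    then have lt: "sum (seq_weight m t) (S' - U) < sum (seq_weight m s) (S - U)"
      using W US S by (simp add: sum_diff)
    have w: "seq_weight m s (t ! i) = seq_weight m t (t ! i)" using i same by simp
    show "0 \<le> seq_weight m s (t ! i) / sum (seq_weight m s) (S - set (take i t))"
      "seq_weight m s (t ! i) / sum (seq_weight m s) (S - set (take i t))
        < seq_weight m t (t ! i) / sum (seq_weight m t) (S' - set (take i t))"
      unfolding U_def[symmetric] w using lt gt seq_weight_pos[OF S(5), of t "t ! i"]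
      by (auto intro: divide_strict_left_mono)
  qed
  \<comment> \<open>Strictness needs at least one factor: the empty sequence has probability 1 under
    every concept.\<close>
  have "(\<Prod>i<length t. seq_weight m s (t ! i) / sum (seq_weight m s) (S - set (take i t)))
      < (\<Prod>i<length t. seq_weight m t (t ! i) / sum (seq_weight m t) (S' - set (take i t)))"
    by (rule prod_mono_strict[of 0]) (use t factor in \<open>force simp: less_imp_le\<close>)+
  then show ?thesis
    using prob_seq_weights[OF dt tS] t.prob_seq_weights[OF dt t(1)] by simp
qed

subsection \<open>MLE-learners for injective consistent teachers\<close>

text \<open>The uniform priors cancel. Without replacement, full support on the consistent examples
  makes \<open>N_plus\<close> equal to \<open>card X\<close>, so the size condition holds for every
  consistent sample.\<close>

lemma MLE_TD_leI:
  assumes tr: "labeled_example_triple X C"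
    and q: "\<And>c z. c \<in> C \<Longrightarrow> q c z \<ge> 0" "\<And>c. c \<in> C \<Longrightarrow> sum (q c) (consistent_examples X c) = 1"
      "\<And>c z. c \<in> C \<Longrightarrow> z \<notin> consistent_examples X c \<Longrightarrow> q c z = 0"
    and pos: "\<And>c z. \<beta> = Without_Repl \<Longrightarrow> c \<in> C \<Longrightarrow> z \<in> consistent_examples X c \<Longrightarrow> q c z > 0"
    and T: "\<And>c. c \<in> C \<Longrightarrow> T c \<in> samples \<alpha> \<beta> (labeled_examples X)"
      "\<And>c. c \<in> C \<Longrightarrow> sample_set (T c) \<subseteq> consistent_examples X c"
    and less: "\<And>c c'. c \<in> C \<Longrightarrow> c' \<in> C \<Longrightarrow> c' \<noteq> c \<Longrightarrow>
      sample_prob \<beta> (q c') (T c) < sample_prob \<beta> (q c) (T c)"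
  shows "MLE_TD \<alpha> \<beta> X C \<le> enat (teacher_order C T)"
proof -
  note X = tripleD[OF tr]
  define L where "L = \<lparr>prior = \<lambda>c. 1 / real (card C), likelihood = q\<rparr>"
  have "(\<Sum>z\<in>labeled_examples X. q c z) = 1" if "c \<in> C" for c
    using sum.mono_neutral_right[OF finite_labeled_examples[OF X(1)] consistent_examples_subset[of X c], of "q c"]
      q that by auto
  then have L: "MLE_learner X C L"
    using X q by (auto simp: MLE_learner_def MAP_learner_def L_def consistent_examples_def)
  have "is_teacher \<alpha> \<beta> X C L T"
    unfolding is_teacher_def
  proof (intro ballI conjI impI)
    fix c assume c: "c \<in> C"
    show "T c \<in> samples \<alpha> \<beta> (labeled_examples X)" by (rule T(1)[OF c])
    show "unique_maximizer (\<lambda>c'. prior L c' * sample_prob \<beta> (likelihood L c') (T c)) C c"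
      using c less X(6) by (intro unique_maximizerI) (auto simp: L_def divide_strict_right_mono)
    assume \<beta>: "\<beta> = Without_Repl"
    have "{z \<in> labeled_examples X. likelihood L c z > 0} = consistent_examples X c" if "c \<in> C" for c
      using pos[OF \<beta> that] q(3)[OF that] consistent_examples_subset[of X c] by (force simp: L_def)
    then have N: "N_plus X C L = card X"
      using X unfolding N_plus_def by (simp add: card_consistent_examples cong: image_cong_simp)
    have "sample_size (T c) = card (sample_set (T c))"
      using T(1)[OF c] unfolding \<beta> by (cases \<alpha>) (auto simp: distinct_card)
    also have "\<dots> \<le> card X"
      using card_mono[OF finite_consistent_examples[OF X(1)] T(2)[OF c]]
      by (simp add: card_consistent_examples)
    finally show "sample_size (T c) \<le> N_plus X C L" by (simp add: N)
  qed
  then have "MAP_TD_learner \<alpha> \<beta> X C L \<le> enat (teacher_order C T)"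
    unfolding MAP_TD_learner_def by (auto intro: INF_lower)
  moreover have "MLE_TD \<alpha> \<beta> X C \<le> MAP_TD_learner \<alpha> \<beta> X C L"
    unfolding MLE_TD_def using L by (auto intro: INF_lower)
  ultimately show ?thesis by (rule order_trans[rotated])
qed

section \<open>Multisets and their empirical distributions\<close>

definition empirical :: "'z multiset \<Rightarrow> 'z \<Rightarrow> real" where
  "empirical A z = real (count A z) / real (size A)"

lemma sum_empirical:
  assumes "A \<noteq> {#}" "finite S" "set_mset A \<subseteq> S"
  shows "sum (empirical A) S = 1"
proof -
  have "sum (empirical A) S = sum (empirical A) (set_mset A)"
    using assms by (intro sum.mono_neutral_right) (auto simp: empirical_def count_eq_zero_iff)
  also have "\<dots> = real (\<Sum>z\<in>set_mset A. count A z) / real (size A)"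
    by (simp add: empirical_def sum_divide_distrib)
  also have "\<dots> = 1"
    using assms(1) unfolding size_multiset_overloaded_eq[symmetric] by simp
  finally show ?thesis .
qed

text \<open>The multinomial coefficient is common to both sides. If \<open>q\<close> is positive on
  \<open>A\<close>, apply \<open>ln x <= x - 1\<close>, with equality only at \<open>x = 1\<close>,
  to the ratios of \<open>q\<close> to the empirical distribution; otherwise the left side is
  0.\<close>

lemma prob_mset_less_empirical:
  assumes A: "A \<noteq> {#}" and S: "finite S"
    and q: "\<And>z. q z \<ge> 0" "sum q S = 1" "\<And>z. z \<notin> S \<Longrightarrow> q z = 0"
    and neq: "q \<noteq> empirical A"
  shows "prob_mset_repl q A < prob_mset_repl (empirical A) A"
proof -
  let ?n = "real (size A)"
  let ?e = "empirical A"
  have n: "?n > 0" using A by (simp add: nonempty_has_size)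
  have e: "?e z > 0" if "z \<in># A" for z using that n by (simp add: empirical_def)
  have epos: "(\<Prod>z\<in>set_mset A. ?e z ^ count A z) > 0" using e by (intro prod_pos) auto
  have "(\<Prod>z\<in>set_mset A. q z ^ count A z) < (\<Prod>z\<in>set_mset A. ?e z ^ count A z)"
  proof (cases "\<exists>z\<in>#A. q z = 0")
    case True
    then have "(\<Prod>z\<in>set_mset A. q z ^ count A z) = 0"
      by (intro prod_zero) (auto simp: count_eq_zero_iff)
    also note epos
    finally show ?thesis .
  next
    case False
    then have qpos: "q z > 0" if "z \<in># A" for z using q(1)[of z] that by (auto simp: less_le)
    then have AS: "set_mset A \<subseteq> S" using q(3) by force
    \<comment> \<open>If \<open>q\<close> agreed with the empirical distribution on
      \<open>A\<close>, it would already have mass 1 there, vanish elsewhere, and so agree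
      everywhere.\<close>
    have "\<exists>z\<in>#A. q z \<noteq> ?e z"
    proof (rule ccontr)
      assume "\<not> ?thesis"
      then have eq: "q z = ?e z" if "z \<in># A" for z using that by auto
      have "sum q (set_mset A) = sum ?e (set_mset A)" using eq by (intro sum.cong) auto
      also have "\<dots> = 1" using A by (intro sum_empirical) auto
      finally have "sum q (S - set_mset A) = 0" using sum_diff[OF S AS, of q] q(2) by simp
      then have "\<forall>z\<in>S - set_mset A. q z = 0"
        using S q(1) by (subst (asm) sum_nonneg_eq_0_iff) auto
      then have "q z = ?e z" for z
        using eq[of z] q(3)[of z] by (cases "z \<in># A"; cases "z \<in> S") (auto simp: empirical_def not_in_iff)
      then show False using neq by auto
    qed
    then obtain z0 where z0: "z0 \<in># A" "q z0 \<noteq> ?e z0" by blast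
    define x where "x z = q z / ?e z" for z
    have xpos: "x z > 0" if "z \<in># A" for z using e qpos that by (simp add: x_def)
    have "(\<Sum>z\<in>set_mset A. real (count A z) * ln (x z))
        < (\<Sum>z\<in>set_mset A. real (count A z) * (x z - 1))"
    proof (rule sum_strict_mono_ex1)
      show "\<forall>z\<in>set_mset A. real (count A z) * ln (x z) \<le> real (count A z) * (x z - 1)"
        using xpos by (auto intro!: mult_left_mono ln_le_minus_one)
      have "x z0 \<noteq> 1" using z0 e[of z0] by (auto simp: x_def)
      then have "ln (x z0) \<noteq> x z0 - 1" using ln_eq_minus_one[of "x z0"] xpos z0 by auto
      then have "ln (x z0) < x z0 - 1" using ln_le_minus_one[of "x z0"] xpos z0 by force
      then show "\<exists>z\<in>set_mset A. real (count A z) * ln (x z) < real (count A z) * (x z - 1)"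
        using z0 by (intro bexI[of _ z0]) auto
    qed simp
    also have "\<dots> = (\<Sum>z\<in>set_mset A. ?n * q z - ?n * ?e z)"
      using n by (intro sum.cong) (auto simp: x_def empirical_def field_simps)
    also have "\<dots> = ?n * (sum q (set_mset A) - sum ?e (set_mset A))"
      by (simp add: sum_subtractf sum_distrib_left right_diff_distrib)
    also have "sum ?e (set_mset A) = 1" using A by (intro sum_empirical) auto
    also have "?n * (sum q (set_mset A) - 1) \<le> 0"
      using n sum_mono2[OF S AS, of q] q by (intro mult_nonneg_nonpos) auto
    finally have "(\<Sum>z\<in>set_mset A. real (count A z) * ln (x z)) < 0" .
    moreover have "(\<Sum>z\<in>set_mset A. real (count A z) * ln (x z)) = ln (\<Prod>z\<in>set_mset A. x z ^ count A z)"
    proof (subst ln_prod)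
      show "x z ^ count A z \<noteq> 0" if "z \<in> set_mset A" for z using xpos[of z] that by simp
      show "(\<Sum>z\<in>set_mset A. real (count A z) * ln (x z)) = (\<Sum>z\<in>set_mset A. ln (x z ^ count A z))"
        using xpos by (intro sum.cong) (auto simp: ln_realpow)
    qed simp
    moreover have "(\<Prod>z\<in>set_mset A. x z ^ count A z) > 0"
      using xpos by (intro prod_pos) auto
    ultimately have "(\<Prod>z\<in>set_mset A. x z ^ count A z) < 1" by simp
    then show ?thesis
      using epos by (simp add: x_def power_divide prod_dividef)
  qed
  moreover have "fact (size A) / (\<Prod>z\<in>set_mset A. fact (count A z)) > (0 :: real)"
    by (intro divide_pos_pos prod_pos) auto
  ultimately show ?thesis
    unfolding prob_mset_repl_def by (rule mult_strict_left_mono)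
qed

text \<open>Without a multiplicity-1 element, a multiset may be a multiple of another one and hence
  have the same empirical distribution.\<close>

lemma empirical_inject:
  assumes "empirical A = empirical B" "count A a = 1" "count B b = 1"
  shows "A = B"
proof -
  have ne: "A \<noteq> {#}" "B \<noteq> {#}" using assms by auto
  then have nz: "size A > 0" "size B > 0" by (auto simp: nonempty_has_size[symmetric])
  have eq: "count A z * size B = count B z * size A" for z
  proof -
    have "real (count A z) / real (size A) = real (count B z) / real (size B)"
      using fun_cong[OF assms(1), of z] by (simp add: empirical_def)
    then have "real (count A z * size B) = real (count B z * size A)"
      using ne by (simp add: frac_eq_eq)
    then show ?thesis by (simp only: of_nat_eq_iff)
  qed
  have "size B \<le> count A b * size B" if "count A b > 0" using that by simp
  moreover have "count A b > 0" using eq[of b] nz assms(3) by (metis gr0I mult_is_0 neq0_conv nat_mult_1)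
  moreover have "count B a > 0" using eq[of a] nz assms(2) by (metis gr0I mult_is_0 neq0_conv nat_mult_1)
  ultimately have "size B \<le> size A" "size A \<le> size B" using eq[of a] eq[of b] assms by auto
  then have "size A = size B" by simp
  then show ?thesis using eq ne by (intro multiset_eqI) auto
qed

text \<open>The samples that the likelihoods above cannot serve. For multisets the condition covers
  \<open>{#}\<close>, so a nondegenerate sample is never empty.\<close>

primrec degenerate :: "'z sample \<Rightarrow> bool" where
  "degenerate (Seq zs) \<longleftrightarrow> zs = []"
| "degenerate (MSet A) \<longleftrightarrow> (\<forall>z. count A z \<noteq> 1)"
| "degenerate (FSet A) \<longleftrightarrow> A = {}"

lemma MLE_TD_le_nondegenerate:
  assumes mode: "(\<alpha>, \<beta>) \<noteq> (Ordered, With_Repl)"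
    and tr: "labeled_example_triple X C"
    and inj: "inj_on T C"
    and T: "\<And>c. c \<in> C \<Longrightarrow> T c \<in> samples \<alpha> \<beta> (labeled_examples X)"
      "\<And>c. c \<in> C \<Longrightarrow> sample_set (T c) \<subseteq> consistent_examples X c"
      "\<And>c. c \<in> C \<Longrightarrow> \<not> degenerate (T c)"
  shows "MLE_TD \<alpha> \<beta> X C \<le> enat (teacher_order C T)"
proof -
  note X = tripleD[OF tr]
  define m where "m = card X"
  have m: "m > 0" using X by (simp add: m_def)
  let ?Z = "consistent_examples X"
  have Z: "finite (?Z c)" "?Z c \<noteq> {}" "card (?Z c) = m" for c
    using X finite_consistent_examples card_consistent_examples[of X c] by (auto simp: m_def consistent_examples_eq)
  have Z_inj: "c = c'" if "c \<in> C" "c' \<in> C" "?Z c \<subseteq> ?Z c'" for c c'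
    using consistent_examples_subsetD[OF that(3)] X(7) that by simp
  have T_neq: "T c' \<noteq> T c" if "c \<in> C" "c' \<in> C" "c' \<noteq> c" for c c'
    using inj_on_eq_iff[OF inj] that by metis
  \<comment> \<open>Common to both modes without replacement: positive weights on all consistent
    examples yield a learner with full support, and only the comparison of probabilities
    remains.\<close>
  have norepl: "MLE_TD \<alpha> Without_Repl X C \<le> enat (teacher_order C T)"
    if T1: "\<And>c. c \<in> C \<Longrightarrow> T c \<in> samples \<alpha> Without_Repl (labeled_examples X)"
      and pos: "\<And>c z. w c z > 0"
      and less: "\<And>c c'. c \<in> C \<Longrightarrow> c' \<in> C \<Longrightarrow> c' \<noteq> c \<Longrightarrow>
        sample_prob Without_Repl (normalize_on (w c') (?Z c')) (T c)
        < sample_prob Without_Repl (normalize_on (w c) (?Z c)) (T c)" for w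
  proof -
    have w: "weights (w c) (?Z c)" for c by unfold_locales (use Z pos in auto)
    have p: "normalize_on (w c) (?Z c) z > 0" if "z \<in> ?Z c" for c z
      using weights.sum_pos[OF w, of c] pos that by (simp add: normalize_on_def)
    have 1: "sum (normalize_on (w c) (?Z c)) (?Z c) = 1" for c
      using weights.sum_pos[OF w, of c] by (simp add: normalize_on_def sum_divide_distrib[symmetric])
    show ?thesis
      by (rule MLE_TD_leI[OF tr, where q = "\<lambda>c. normalize_on (w c) (?Z c)"])
         (use T1 T(2) less p 1 in \<open>auto simp: normalize_on_def less_imp_le\<close>)
  qed
  consider "\<alpha> = Unordered" "\<beta> = With_Repl" | "\<alpha> = Ordered" "\<beta> = Without_Repl"
    | "\<alpha> = Unordered" "\<beta> = Without_Repl"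
    using mode by (cases \<alpha>; cases \<beta>) auto
  then show ?thesis
  proof cases
    case 1
    \<comment> \<open>The mode fixes the constructor of \<open>T c\<close>; the description operator
      only strips it.\<close>
    define A where "A c = (THE A. T c = MSet A)" for c
    have TA: "T c = MSet (A c)" if "c \<in> C" for c
      using T(1)[OF that] 1 by (auto simp: A_def)
    have sub: "set_mset (A c) \<subseteq> ?Z c" if "c \<in> C" for c using T(2)[OF that] TA[OF that] by simp
    have one: "\<exists>a. count (A c) a = 1" if "c \<in> C" for c using T(3)[OF that] TA[OF that] by simp
    then have ne: "A c \<noteq> {#}" if "c \<in> C" for c using that by (metis count_empty zero_neq_one)
    have e1: "sum (empirical (A c)) (?Z c) = 1" if "c \<in> C" for c
      by (rule sum_empirical[OF ne[OF that] Z(1) sub[OF that]])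
    have e0: "empirical (A c) z = 0" if "c \<in> C" "z \<notin> ?Z c" for c z
    proof -
      have "z \<notin># A c" using sub[OF that(1)] that(2) by blast
      then show ?thesis by (simp add: empirical_def not_in_iff)
    qed
    show ?thesis
    proof (rule MLE_TD_leI[OF tr, where q = "\<lambda>c. empirical (A c)"])
      fix c c' assume c: "c \<in> C" "c' \<in> C" "c' \<noteq> c"
      have "empirical (A c') \<noteq> empirical (A c)"
      proof
        assume eq: "empirical (A c') = empirical (A c)"
        obtain a b where "count (A c') a = 1" "count (A c) b = 1"
          using one[OF c(1)] one[OF c(2)] by blast
        then have "A c' = A c" by (rule empirical_inject[OF eq])
        then show False using T_neq[OF c] TA c by simp
      qed
      then have "prob_mset_repl (empirical (A c')) (A c) < prob_mset_repl (empirical (A c)) (A c)"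
        using e1[OF c(2)] e0[OF c(2)] ne[OF c(1)] Z(1)[of c']
        by (intro prob_mset_less_empirical[of "A c" "?Z c'"]) (auto simp: empirical_def)
      then show "sample_prob \<beta> (empirical (A c')) (T c) < sample_prob \<beta> (empirical (A c)) (T c)"
        using TA[OF c(1)] by simp
    qed (use 1 T e1 e0 in \<open>auto simp: empirical_def\<close>)
  next
    case 2
    define s where "s c = (THE s. T c = Seq s)" for c
    have Ts: "T c = Seq (s c)" if "c \<in> C" for c
      using T(1)[OF that] 2 by (auto simp: s_def)
    have s: "set (s c) \<subseteq> ?Z c" "s c \<noteq> []" "distinct (s c)" if "c \<in> C" for c
      using T[OF that] Ts[OF that] 2 by auto
    show ?thesis unfolding 2(2)
    proof (rule norepl[of "\<lambda>c. seq_weight m (s c)"])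
      fix c c' assume c: "c \<in> C" "c' \<in> C" "c' \<noteq> c"
      let ?p = "\<lambda>c'. prob_seq_norepl (normalize_on (seq_weight m (s c')) (?Z c')) (s c)"
      have "?p c' < ?p c"
      \<comment> \<open>When \<open>s c\<close> is a prefix of \<open>s c'\<close>, its probability
        under \<open>c'\<close> may exceed 1/2 too, so the threshold 1/2 cannot separate the two
        concepts.\<close>
      proof (cases "s c = take (length (s c)) (s c')")
        case True
        have "s c \<noteq> s c'" using T_neq[OF c] Ts c by auto
        then have "length (s c) < length (s c')" using True by (metis not_less take_all)
        then show ?thesis
          using s c Z m True by (intro prob_seq_prefix_less) auto
      next
        case False
        have "set (s c) \<noteq> ?Z c'" using Z_inj[of c' c] s(1)[of c] c by auto
        then have "?p c' \<le> 1 / 2"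
          using s c Z m False by (intro prob_seq_other_le_half) auto
        moreover have "1 / 2 < ?p c"
          using s c Z m by (intro prob_seq_own_gt_half) auto
        ultimately show ?thesis by simp
      qed
      then show "sample_prob Without_Repl (normalize_on (seq_weight m (s c')) (?Z c')) (T c)
        < sample_prob Without_Repl (normalize_on (seq_weight m (s c)) (?Z c)) (T c)"
        using Ts[OF c(1)] by simp
    qed (use 2 T m in \<open>auto simp: seq_weight_pos\<close>)
  next
    case 3
    define A where "A c = (THE A. T c = FSet A)" for c
    have TA: "T c = FSet (A c)" if "c \<in> C" for c
      using T(1)[OF that] 3 by (auto simp: A_def)
    have A: "A c \<subseteq> ?Z c" "A c \<noteq> {}" if "c \<in> C" for c
      using T[OF that] TA[OF that] by auto
    show ?thesis unfolding 3(2)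
    proof (rule norepl[of "\<lambda>c. set_weight m (A c)"])
      fix c c' assume c: "c \<in> C" "c' \<in> C" "c' \<noteq> c"
      let ?p = "\<lambda>c'. prob_set_norepl (normalize_on (set_weight m (A c')) (?Z c')) (A c)"
      have "A c \<noteq> A c'" using T_neq[OF c] TA c by auto
      moreover have "A c \<noteq> ?Z c'" using Z_inj[of c' c] A(1)[of c] c by auto
      ultimately have "?p c' \<le> 1 / 2"
        using A c Z m by (intro prob_set_other_le_half) auto
      moreover have "1 / 2 < ?p c"
        using A c Z m by (intro prob_set_own_gt_half) auto
      ultimately show "sample_prob Without_Repl (normalize_on (set_weight m (A c')) (?Z c')) (T c)
        < sample_prob Without_Repl (normalize_on (set_weight m (A c)) (?Z c)) (T c)"
        using TA[OF c(1)] by simp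
    qed (use 3 T m in \<open>auto simp: set_weight_pos\<close>)
  qed
qed

subsection \<open>From MAP-teachers to MLE-teachers\<close>

text \<open>Invariant under adding elements of multiplicity 1 to a degenerate sample.\<close>

primrec repeated_part :: "'z sample \<Rightarrow> 'z sample" where
  "repeated_part (Seq zs) = Seq []"
| "repeated_part (MSet A) = MSet (filter_mset (\<lambda>z. count A z \<noteq> 1) A)"
| "repeated_part (FSet A) = FSet {}"

text \<open>Listing every consistent example once gives all of them multiplicity 1, and
  \<open>X\<close> being nonempty rules out the empty sample.\<close>

lemma ex_nondegenerate_full:
  assumes "finite X" "X \<noteq> {}"
  shows "\<exists>s\<in>samples \<alpha> \<beta> (labeled_examples X). sample_set s = consistent_examples X c \<and>
    sample_size s = card X \<and> \<not> degenerate s"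
proof -
  let ?Z = "consistent_examples X c"
  note Z = finite_consistent_examples[OF assms(1), of c] card_consistent_examples[of X c]
    consistent_examples_subset[of X c]
  have ne: "?Z \<noteq> {}" using assms by (simp add: consistent_examples_eq)
  obtain zs where zs: "set zs = ?Z" "distinct zs" "length zs = card X"
    using finite_distinct_list[OF Z(1)] Z(2) by (metis distinct_card)
  have "Seq zs \<in> samples Ordered \<beta> (labeled_examples X)" for \<beta>
    using zs Z by (cases \<beta>) auto
  moreover have "MSet (mset_set ?Z) \<in> samples Unordered With_Repl (labeled_examples X)"
    using Z by auto
  moreover have "FSet ?Z \<in> samples Unordered Without_Repl (labeled_examples X)"
    using Z by auto
  moreover have "\<not> degenerate (Seq zs)" using zs ne by auto
  moreover have "\<not> degenerate (MSet (mset_set ?Z))"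
  proof -
    obtain z where "z \<in> ?Z" using ne by blast
    then show ?thesis using Z(1) by (auto intro!: exI[of _ "fst z"] exI[of _ "snd z"])
  qed
  moreover have "\<not> degenerate (FSet ?Z)" using ne by simp
  ultimately show ?thesis
    using Z zs by (cases \<alpha>; cases \<beta>) (fastforce simp: size_mset_set)+
qed

text \<open>A degenerate sequence or set is empty and is replaced by \<open>n\<close> consistent
  examples. A degenerate multiset receives \<open>n - size A\<close> fresh ones, which
  \<open>repeated_part\<close> removes again; enough are available because \<open>A\<close> has at
  most \<open>size A\<close> distinct elements.\<close>

lemma ex_nondegenerate_extension:
  assumes "finite X" "n \<le> card X"
    and s: "s \<in> samples \<alpha> \<beta> (labeled_examples X)" "sample_set s \<subseteq> consistent_examples X c"
      "degenerate s" "sample_size s < n"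
  shows "\<exists>s'\<in>samples \<alpha> \<beta> (labeled_examples X). sample_set s' \<subseteq> consistent_examples X c \<and>
    sample_size s' = n \<and> \<not> degenerate s' \<and> repeated_part s' = s"
proof -
  let ?Z = "consistent_examples X c"
  note Z = finite_consistent_examples[OF assms(1), of c] card_consistent_examples[of X c]
    consistent_examples_subset[of X c]
  show ?thesis
  proof (cases s)
    case (Seq zs)
    obtain W where W: "W \<subseteq> ?Z" "card W = n" "finite W"
      using obtain_subset_with_card_n[of n ?Z] assms(2) Z by metis
    obtain ws where ws: "set ws = W" "distinct ws"
      using finite_distinct_list[OF W(3)] by metis
    have "length ws = n" using ws W by (metis distinct_card)
    then show ?thesis
      using Seq s W ws Z by (cases \<alpha>; cases \<beta>) (auto intro!: bexI[of _ "Seq ws"])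
  next
    case (FSet A)
    obtain W where W: "W \<subseteq> ?Z" "card W = n" "finite W"
      using obtain_subset_with_card_n[of n ?Z] assms(2) Z by metis
    have "FSet W \<in> samples \<alpha> \<beta> (labeled_examples X)"
      using FSet s(1) W Z by (cases \<alpha>; cases \<beta>) auto
    moreover have "W \<noteq> {}" using W s(4) by auto
    ultimately show ?thesis
      using FSet s W by (intro bexI[of _ "FSet W"]) auto
  next
    case (MSet A)
    have mode: "\<alpha> = Unordered" "\<beta> = With_Repl" using s MSet by (cases \<alpha>; cases \<beta>; auto)+
    have A: "set_mset A \<subseteq> ?Z" "size A < n" and no1: "\<And>z. count A z \<noteq> 1" using s MSet by auto
    have "(\<Sum>z\<in>set_mset A. 1) \<le> (\<Sum>z\<in>set_mset A. count A z)"
      by (rule sum_mono) (simp add: Suc_le_eq)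
    then have "card (set_mset A) \<le> size A" by (simp add: size_multiset_overloaded_eq)
    then have "n - size A \<le> card (?Z - set_mset A)"
      using A Z assms(2) by (simp add: card_Diff_subset)
    then obtain W where W: "W \<subseteq> ?Z - set_mset A" "card W = n - size A" "finite W"
      using obtain_subset_with_card_n by metis
    define B where "B = A + mset_set W"
    have cB: "count B z = (if z \<in> W then 1 else count A z)" for z
      using W by (auto simp: B_def not_in_iff count_mset_set')
    have "W \<noteq> {}" using W A by auto
    then have "\<not> degenerate (MSet B)" by (auto simp: cB)
    moreover have "repeated_part (MSet B) = MSet A"
      using W no1 by (auto simp: cB not_in_iff intro!: multiset_eqI)
    moreover have "set_mset B \<subseteq> ?Z" using A W by (auto simp: B_def)
    moreover have "size B = n" using A W by (simp add: B_def)
    ultimately show ?thesis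
      using MSet Z by (intro bexI[of _ "MSet B"]) (auto simp: mode)
  qed
qed

section \<open>Injectivity and consistency of MAP-teachers\<close>

lemma prob_seq_repl_eq_0: "z \<in> set zs \<Longrightarrow> q z = 0 \<Longrightarrow> prob_seq_repl q zs = 0"
  by (auto simp: prob_seq_repl_def in_set_conv_nth intro!: prod_zero)

lemma prob_mset_repl_eq_0: "z \<in># A \<Longrightarrow> q z = 0 \<Longrightarrow> prob_mset_repl q A = 0"
  by (auto simp: prob_mset_repl_def intro!: bexI[of _ z])

lemma sample_prob_eq_0:
  assumes "z \<in> sample_set s" "q z = 0"
  shows "sample_prob \<beta> q s = 0"
  using assms by (cases s; cases \<beta>)
    (auto intro: prob_seq_repl_eq_0 prob_mset_repl_eq_0 prob_seq_norepl_eq_0 prob_set_norepl_eq_0)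

lemma sample_prob_nonneg:
  assumes "finite Z" "\<And>z. z \<in> Z \<Longrightarrow> q z \<ge> 0" "sum q Z = 1" "s \<in> samples \<alpha> \<beta> Z"
  shows "sample_prob \<beta> q s \<ge> 0"
proof (cases \<alpha>)
  case Ordered
  show ?thesis
  proof (cases \<beta>)
    case With_Repl
    then obtain zs where "s = Seq zs" "set zs \<subseteq> Z" using assms(4) Ordered by (auto simp: in_lists_conv_set)
    then show ?thesis using With_Repl assms(2) by (auto simp: prob_seq_repl_def subset_iff intro!: prod_nonneg)
  next
    case Without_Repl
    then obtain zs where "s = Seq zs" "set zs \<subseteq> Z" "distinct zs" using assms(4) Ordered by auto
    then show ?thesis using Without_Repl prob_seq_norepl_nonneg[OF assms(1,2)] assms(3) by simp
  qed
next
  case Unordered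
  show ?thesis
  proof (cases \<beta>)
    case With_Repl
    then obtain A where "s = MSet A" "set_mset A \<subseteq> Z" using assms(4) Unordered by auto
    then show ?thesis using assms(2)
      by (auto simp: prob_mset_repl_def intro!: mult_nonneg_nonneg divide_nonneg_nonneg prod_nonneg)
  next
    case Without_Repl
    then obtain A where "s = FSet A" "A \<subseteq> Z" using assms(4) Unordered by auto
    then show ?thesis using prob_set_norepl_nonneg[OF assms(1,2)] assms(3) by simp
  qed
qed

lemma teacher_properties:
  assumes tr: "labeled_example_triple X C" and L: "MAP_learner X C L"
    and T: "is_teacher \<alpha> \<beta> X C L T"
  shows "inj_on T C"
    and "\<And>c. c \<in> C \<Longrightarrow> T c \<in> samples \<alpha> \<beta> (labeled_examples X)"
    and "\<And>c. c \<in> C \<Longrightarrow> sample_set (T c) \<subseteq> consistent_examples X c"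
proof -
  note X = tripleD[OF tr]
  let ?f = "\<lambda>c0 c. prior L c * sample_prob \<beta> (likelihood L c) (T c0)"
  have um: "unique_maximizer (?f c) C c" and smp: "T c \<in> samples \<alpha> \<beta> (labeled_examples X)"
    if "c \<in> C" for c
    using T that by (auto simp: is_teacher_def)
  show "T c \<in> samples \<alpha> \<beta> (labeled_examples X)" if "c \<in> C" for c by (rule smp[OF that])
  show "inj_on T C"
  proof (rule inj_onI, rule ccontr)
    fix c c' assume c: "c \<in> C" "c' \<in> C" "T c = T c'" "c \<noteq> c'"
    then show False
      using unique_maximizerD[OF um[OF c(1)] c(2)] unique_maximizerD[OF um[OF c(2)] c(1)] by simp
  qed
  show "sample_set (T c) \<subseteq> consistent_examples X c" if c: "c \<in> C" for c
  proof
    fix z assume z: "z \<in> sample_set (T c)"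
    \<comment> \<open>A competitor exists because \<open>card C\<close> is at least 2. Its value is
      nonnegative, so the strict maximum is positive and no drawn example has likelihood 0 under
      \<open>c\<close>.\<close>
    obtain c' where c': "c' \<in> C" "c' \<noteq> c" using X(8)[OF c] by blast
    have "sample_prob \<beta> (likelihood L c') (T c) \<ge> 0"
      by (rule sample_prob_nonneg[OF finite_labeled_examples[OF X(1)] _ _ smp[OF c]])
         (use L c' in \<open>auto simp: MAP_learner_def\<close>)
    then have "0 \<le> ?f c c'" using L c' by (auto simp: MAP_learner_def less_imp_le)
    also have "\<dots> < ?f c c" by (rule unique_maximizerD[OF um[OF c] c'])
    finally have "likelihood L c z \<noteq> 0" using sample_prob_eq_0[OF z] by auto
    moreover have "z \<in> labeled_examples X"
      using z smp[OF c] by (cases \<alpha>; cases \<beta>) auto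
    ultimately show "z \<in> consistent_examples X c"
      using L c by (auto simp: MAP_learner_def consistent_examples_def)
  qed
qed

lemma teacher_order_le:
  assumes "finite C" "C \<noteq> {}"
  shows "teacher_order C T \<le> n \<longleftrightarrow> (\<forall>c\<in>C. sample_size (T c) \<le> n)"
  using assms by (auto simp: teacher_order_def)

section \<open>Upper bounds on the MLE teaching dimension\<close>

lemma MLE_TD_le_card:
  assumes "(\<alpha>, \<beta>) \<noteq> (Ordered, With_Repl)" "labeled_example_triple X C"
  shows "MLE_TD \<alpha> \<beta> X C \<le> enat (card X)"
proof -
  note X = tripleD[OF assms(2)]
  obtain U where U: "U c \<in> samples \<alpha> \<beta> (labeled_examples X)"
    "sample_set (U c) = consistent_examples X c"
    "sample_size (U c) = card X" "\<not> degenerate (U c)" for c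
    using ex_nondegenerate_full[OF X(1,2), of \<alpha> \<beta>] by metis
  have "inj_on U C"
  proof (rule inj_onI)
    fix c c' assume "c \<in> C" "c' \<in> C" "U c = U c'"
    then show "c = c'"
      using U(2)[of c] U(2)[of c'] consistent_examples_subsetD[of X c c'] X(7) by simp
  qed
  then have "MLE_TD \<alpha> \<beta> X C \<le> enat (teacher_order C U)"
    by (rule MLE_TD_le_nondegenerate[OF assms]) (use U in auto)
  also have "teacher_order C U \<le> card X" using X(3,4) U by (simp add: teacher_order_le)
  finally show ?thesis by simp
qed

lemma MLE_TD_le_teacher:
  assumes mode: "(\<alpha>, \<beta>) \<noteq> (Ordered, With_Repl)"
    and tr: "labeled_example_triple X C" and L: "MAP_learner X C L"
    and T: "is_teacher \<alpha> \<beta> X C L T"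
  shows "MLE_TD \<alpha> \<beta> X C \<le> enat (Suc (teacher_order C T))"
proof -
  note X = tripleD[OF tr]
  note TP = teacher_properties[OF tr L T]
  define d where "d = teacher_order C T"
  have Td: "sample_size (T c) \<le> d" if "c \<in> C" for c
    using teacher_order_le[OF X(3,4), of T d] that by (simp add: d_def)
  show ?thesis
  proof (cases "card X \<le> d")
    case True
    have "MLE_TD \<alpha> \<beta> X C \<le> enat (card X)" by (rule MLE_TD_le_card[OF mode tr])
    also have "card X \<le> Suc d" using True by simp
    finally show ?thesis by (simp add: d_def)
  next
    case False
    then have "Suc d \<le> card X" by simp
    define P where "P c s \<longleftrightarrow> s \<in> samples \<alpha> \<beta> (labeled_examples X) \<and>
      sample_set s \<subseteq> consistent_examples X c \<and> sample_size s = Suc d \<and> \<not> degenerate s \<and>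
      repeated_part s = T c" for c s
    have "\<forall>c. \<exists>s. c \<in> C \<and> degenerate (T c) \<longrightarrow> P c s"
    proof (intro allI)
      fix c
      show "\<exists>s. c \<in> C \<and> degenerate (T c) \<longrightarrow> P c s"
      proof (cases "c \<in> C \<and> degenerate (T c)")
        case True
        then show ?thesis
          using ex_nondegenerate_extension[OF X(1) \<open>Suc d \<le> card X\<close> TP(2,3)] Td[of c]
          unfolding P_def by (auto simp: less_Suc_eq_le)
      qed auto
    qed
    from choice[OF this] obtain E where E': "\<forall>c. c \<in> C \<and> degenerate (T c) \<longrightarrow> P c (E c)" by blast
    have E: "E c \<in> samples \<alpha> \<beta> (labeled_examples X)"
      "sample_set (E c) \<subseteq> consistent_examples X c"
      "sample_size (E c) = Suc d" "\<not> degenerate (E c)" "repeated_part (E c) = T c"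
      if "c \<in> C" "degenerate (T c)" for c
      using E' that by (auto simp: P_def)
    define U where "U c = (if degenerate (T c) then E c else T c)" for c
    have "inj_on U C"
    proof (rule inj_onI)
      fix c c' assume c: "c \<in> C" "c' \<in> C" and eq: "U c = U c'"
      \<comment> \<open>Padded samples have size \<open>Suc d\<close> and unpadded ones at most
        \<open>d\<close>, so these never collide; two equal padded samples have the same
        \<open>repeated_part\<close>.\<close>
      have "T c = T c'"
        using eq E[OF c(1)] E[OF c(2)] Td[OF c(1)] Td[OF c(2)]
        by (auto simp: U_def split: if_splits)
      then show "c = c'" using inj_onD[OF TP(1)] c by simp
    qed
    then have "MLE_TD \<alpha> \<beta> X C \<le> enat (teacher_order C U)"
      by (rule MLE_TD_le_nondegenerate[OF mode tr]) (use E TP in \<open>auto simp: U_def\<close>)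
    also have "teacher_order C U \<le> Suc d"
      using X E Td by (auto simp: teacher_order_le U_def le_SucI)
    finally show ?thesis by (simp add: d_def)
  qed
qed

section \<open>Attained infima and the two inequalities\<close>

lemma enat_INF_attained:
  fixes f :: "'b \<Rightarrow> enat"
  assumes "(INF x\<in>A. f x) \<noteq> \<infinity>"
  obtains x where "x \<in> A" "f x = (INF x\<in>A. f x)"
proof -
  \<comment> \<open>The empty infimum is infinite; a nonempty set of extended naturals attains its
    infimum by well-ordering.\<close>
  have "A \<noteq> {}" using assms by (auto simp: top_enat_def)
  then obtain y where "y \<in> f ` A" by auto
  then have "Inf (f ` A) \<in> f ` A" by (rule wellorder_InfI)
  then show ?thesis using that by auto
qed

lemma MAP_TD_attained:
  assumes "MAP_TD \<alpha> \<beta> X C \<noteq> \<infinity>"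
  obtains L T where "MAP_learner X C L" "is_teacher \<alpha> \<beta> X C L T"
    "MAP_TD \<alpha> \<beta> X C = enat (teacher_order C T)"
proof -
  obtain L where L: "MAP_learner X C L" "MAP_TD_learner \<alpha> \<beta> X C L = MAP_TD \<alpha> \<beta> X C"
    using enat_INF_attained assms unfolding MAP_TD_def by blast
  then have "MAP_TD_learner \<alpha> \<beta> X C L \<noteq> \<infinity>" using assms by simp
  then obtain T where "is_teacher \<alpha> \<beta> X C L T"
    "enat (teacher_order C T) = MAP_TD_learner \<alpha> \<beta> X C L"
    using enat_INF_attained unfolding MAP_TD_learner_def by blast
  then show ?thesis using that L by metis
qed

lemma MLE_TD_attained:
  assumes "MLE_TD \<alpha> \<beta> X C \<noteq> \<infinity>"
  obtains L T where "MLE_learner X C L" "is_teacher \<alpha> \<beta> X C L T"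
    "MLE_TD \<alpha> \<beta> X C = enat (teacher_order C T)"
proof -
  obtain L where L: "MLE_learner X C L" "MAP_TD_learner \<alpha> \<beta> X C L = MLE_TD \<alpha> \<beta> X C"
    using enat_INF_attained assms unfolding MLE_TD_def by blast
  then have "MAP_TD_learner \<alpha> \<beta> X C L \<noteq> \<infinity>" using assms by simp
  then obtain T where "is_teacher \<alpha> \<beta> X C L T"
    "enat (teacher_order C T) = MAP_TD_learner \<alpha> \<beta> X C L"
    using enat_INF_attained unfolding MAP_TD_learner_def by blast
  then show ?thesis using that L by metis
qed

lemma MAP_TD_le_MLE_TD: "MAP_TD \<alpha> \<beta> X C \<le> MLE_TD \<alpha> \<beta> X C"
  unfolding MAP_TD_def MLE_TD_def by (rule INF_superset_mono) (auto simp: MLE_learner_def)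

lemma MLE_TD_le_Suc_MAP_TD:
  assumes "(\<alpha>, \<beta>) \<noteq> (Ordered, With_Repl)" "labeled_example_triple X C"
  shows "MLE_TD \<alpha> \<beta> X C \<le> 1 + MAP_TD \<alpha> \<beta> X C"
proof (cases "MAP_TD \<alpha> \<beta> X C = \<infinity>")
  case False
  then obtain L T where "MAP_learner X C L" "is_teacher \<alpha> \<beta> X C L T"
    "MAP_TD \<alpha> \<beta> X C = enat (teacher_order C T)"
    by (rule MAP_TD_attained)
  then show ?thesis using MLE_TD_le_teacher[OF assms] by (simp add: one_enat_def)
qed simp

subsection \<open>Tightness\<close>

text \<open>At sizes 1 and 0 all four modes give the same probabilities, so these uniform names
  spare the tightness examples a case distinction on the mode.\<close>

primrec singleton_sample :: "ordering \<Rightarrow> replacement \<Rightarrow> 'z \<Rightarrow> 'z sample" where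
  "singleton_sample Ordered \<beta> z = Seq [z]"
| "singleton_sample Unordered \<beta> z =
     (case \<beta> of With_Repl \<Rightarrow> MSet {#z#} | Without_Repl \<Rightarrow> FSet {z})"

primrec empty_sample :: "ordering \<Rightarrow> replacement \<Rightarrow> 'z sample" where
  "empty_sample Ordered \<beta> = Seq []"
| "empty_sample Unordered \<beta> = (case \<beta> of With_Repl \<Rightarrow> MSet {#} | Without_Repl \<Rightarrow> FSet {})"

lemma singleton_sample:
  "sample_size (singleton_sample \<alpha> \<beta> z) = 1"
  "sample_prob \<beta> q (singleton_sample \<alpha> \<beta> z) = q z"
  "singleton_sample \<alpha> \<beta> z \<in> samples \<alpha> \<beta> Z \<longleftrightarrow> z \<in> Z"
  by (cases \<alpha>; cases \<beta>; auto simp: prob_seq_repl_def prob_mset_repl_def prob_seq_norepl_def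
      prob_set_norepl_def)+

lemma empty_sample:
  "sample_size (empty_sample \<alpha> \<beta>) = 0"
  "sample_prob \<beta> q (empty_sample \<alpha> \<beta>) = 1"
  "empty_sample \<alpha> \<beta> \<in> samples \<alpha> \<beta> Z"
  by (cases \<alpha>; cases \<beta>; auto simp: prob_seq_repl_def prob_mset_repl_def prob_seq_norepl_def
      prob_set_norepl_def)+

lemma sample_of_size_0:
  assumes "s \<in> samples \<alpha> \<beta> Z" "finite Z" "sample_size s = 0"
  shows "s = empty_sample \<alpha> \<beta>"
  using assms by (cases \<alpha>; cases \<beta>) (auto dest: finite_subset)

lemma sample_of_size_1:
  assumes "s \<in> samples \<alpha> \<beta> Z" "sample_size s = 1"
  shows "s \<in> singleton_sample \<alpha> \<beta> ` Z"
proof (cases s)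
  case (Seq zs)
  then obtain z where "zs = [z]" using assms(2) by (auto simp: length_Suc_conv)
  then show ?thesis using assms(1) Seq by (cases \<alpha>; cases \<beta>) auto
next
  case (MSet A)
  then obtain z where "A = {#z#}" using assms(2) size_1_singleton_mset by auto
  then show ?thesis using assms(1) MSet by (cases \<alpha>; cases \<beta>) auto
next
  case (FSet A)
  then obtain z where "A = {z}" using assms(2) by (auto simp: card_1_singleton_iff)
  then show ?thesis using assms(1) FSet by (cases \<alpha>; cases \<beta>) auto
qed

text \<open>Both dimensions are 1: \<open>card X = 1\<close> bounds them from above, and order 0
  would teach both concepts by the empty sample, against injectivity.\<close>

lemma MLE_TD_two_concepts:
  fixes a :: 'a
  assumes "(\<alpha>, \<beta>) \<noteq> (Ordered, With_Repl)"
  defines "X \<equiv> {a}" and "C \<equiv> {{}, {a}}"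
  shows "labeled_example_triple X C" "MLE_TD \<alpha> \<beta> X C = MAP_TD \<alpha> \<beta> X C"
proof -
  show tr: "labeled_example_triple X C" by (simp add: X_def C_def labeled_example_triple_def)
  note X = tripleD[OF tr]
  have MLE: "MLE_TD \<alpha> \<beta> X C \<le> 1"
    using MLE_TD_le_card[OF assms(1) tr] by (simp add: X_def one_enat_def)
  have "1 \<le> MAP_TD \<alpha> \<beta> X C"
  proof (rule ccontr)
    assume "\<not> ?thesis"
    then have 0: "MAP_TD \<alpha> \<beta> X C = 0" by (simp add: not_le one_eSuc)
    then obtain L T where T: "MAP_learner X C L" "is_teacher \<alpha> \<beta> X C L T"
      "MAP_TD \<alpha> \<beta> X C = enat (teacher_order C T)"
      using MAP_TD_attained[of \<alpha> \<beta> X C] by auto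
    note TP = teacher_properties[OF tr T(1,2)]
    have "T c = empty_sample \<alpha> \<beta>" if "c \<in> C" for c
      using teacher_order_le[OF X(3,4), of T 0] T(3) 0 that
      by (intro sample_of_size_0[OF TP(2) finite_labeled_examples[OF X(1)]]) (auto simp: zero_enat_def)
    then have "T {} = T {a}" by (simp add: C_def)
    then show False using inj_onD[OF TP(1), of "{}" "{a}"] by (simp add: C_def)
  qed
  then show "MLE_TD \<alpha> \<beta> X C = MAP_TD \<alpha> \<beta> X C"
    using MLE MAP_TD_le_MLE_TD[of \<alpha> \<beta> X C] by simp
qed

text \<open>The empty sample has probability 1 under every concept, so uniform priors produce a
  tie.\<close>

lemma MLE_teacher_nonempty:
  assumes tr: "labeled_example_triple X C" and L: "MLE_learner X C L"
    and T: "is_teacher \<alpha> \<beta> X C L T" and c: "c \<in> C"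
  shows "T c \<noteq> empty_sample \<alpha> \<beta>"
proof
  assume eq: "T c = empty_sample \<alpha> \<beta>"
  obtain c' where c': "c' \<in> C" "c' \<noteq> c" using tripleD(8)[OF tr c] by blast
  have "unique_maximizer (\<lambda>c'. prior L c' * sample_prob \<beta> (likelihood L c') (T c)) C c"
    using T c by (auto simp: is_teacher_def)
  from unique_maximizerD[OF this c'] show False
    using L c c' by (simp add: eq empty_sample MLE_learner_def)
qed

text \<open>Pigeonhole: an MLE-teacher of order at most 1 maps the concepts injectively to singleton
  samples, of which there are at most \<open>2 * card X\<close>.\<close>

lemma MLE_TD_ge_2:
  assumes tr: "labeled_example_triple X C" and card: "2 * card X < card C"
  shows "2 \<le> MLE_TD \<alpha> \<beta> X C"
proof (rule ccontr)
  assume "\<not> ?thesis"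
  then have lt: "MLE_TD \<alpha> \<beta> X C < 2" by simp
  then have "MLE_TD \<alpha> \<beta> X C \<noteq> \<infinity>" by (metis enat_ord_code(6))
  then obtain L T where T: "MLE_learner X C L" "is_teacher \<alpha> \<beta> X C L T"
    "MLE_TD \<alpha> \<beta> X C = enat (teacher_order C T)"
    by (rule MLE_TD_attained)
  note X = tripleD[OF tr]
  have "MAP_learner X C L" using T(1) by (simp add: MLE_learner_def)
  note TP = teacher_properties[OF tr this T(2)]
  have "teacher_order C T \<le> 1" using lt T(3) by (simp add: numeral_eq_enat)
  then have le: "sample_size (T c) \<le> 1" if "c \<in> C" for c
    using teacher_order_le[OF X(3,4), of T 1] that by blast
  have "T c \<in> singleton_sample \<alpha> \<beta> ` labeled_examples X" if c: "c \<in> C" for c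
  proof (rule sample_of_size_1[OF TP(2)[OF c]])
    have "sample_size (T c) \<noteq> 0"
      using sample_of_size_0[OF TP(2)[OF c] finite_labeled_examples[OF X(1)]]
        MLE_teacher_nonempty[OF tr T(1,2) c] by blast
    then show "sample_size (T c) = 1" using le[OF c] by simp
  qed
  then have "T ` C \<subseteq> singleton_sample \<alpha> \<beta> ` labeled_examples X" by auto
  then have "card (T ` C) \<le> card (singleton_sample \<alpha> \<beta> ` labeled_examples X)"
    using finite_labeled_examples[OF X(1)] by (intro card_mono) auto
  also have "\<dots> \<le> card (labeled_examples X)"
    by (rule card_image_le[OF finite_labeled_examples[OF X(1)]])
  also have "\<dots> = 2 * card X" by (simp add: labeled_examples_def card_cartesian_product)
  finally show False using card TP(1) by (simp add: card_image)
qed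

text \<open>The empty concept is taught by the empty sample, which its larger prior allows only
  for a MAP-learner; \<open>{i}\<close> is taught by \<open>(i, 1)\<close>, and \<open>{0, 1, 2} - {k}\<close> by \<open>(k, 0)\<close>.\<close>

lemma MAP_TD_seven_concepts:
  defines "X \<equiv> {0, 1, 2 :: nat}" and "C \<equiv> {{}, {0}, {1}, {2}, {1, 2}, {0, 2}, {0, 1 :: nat}}"
  shows "labeled_example_triple X C" "2 * card X < card C" "MAP_TD \<alpha> \<beta> X C \<le> 1"
proof -
  have cardC: "card C = 7" by (simp add: C_def card_insert_if doubleton_eq_iff)
  have empty_C: "{} \<in> C" by (simp add: C_def)
  have cardX: "card X = 3" by (simp add: X_def)
  show tr: "labeled_example_triple X C"
    unfolding labeled_example_triple_def cardC by (auto simp: X_def C_def)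
  show "2 * card X < card C" by (simp add: cardC cardX)
  note X = tripleD[OF tr]
  define t :: "nat set \<Rightarrow> nat example" where
    "t c = (if card c = 1 then (the_elem c, True) else (the_elem (X - c), False))" for c
  have t: "t {0} = (0, True)" "t {1} = (1, True)" "t {2} = (2, True)"
    "t {1, 2} = (0, False)" "t {0, 2} = (1, False)" "t {0, 1} = (2, False)"
    by (simp_all add: t_def X_def insert_Diff_if)
  \<comment> \<open>With the priors below, the empty sample scores 1/4 for the empty concept against
    1/8 for the others. A sample \<open>t c\<close> scores 1/8 for \<open>c\<close> and at most
    \<open>1/4 * 1/3 = 1/12\<close> for the empty concept, which spreads its mass over the three
    negative examples.\<close>
  define p :: "nat set \<Rightarrow> nat example \<Rightarrow> real" where
    "p c z = (if c = {} then if snd z then 0 else 1 / 3 else if z = t c then 1 else 0)" for c z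
  define L where "L = \<lparr>prior = \<lambda>c. if c = {} then 1 / 4 else 1 / 8, likelihood = p\<rparr>"
  define T where "T c = (if c = {} then empty_sample \<alpha> \<beta> else singleton_sample \<alpha> \<beta> (t c))" for c
  have Z: "labeled_examples X = {(0, True), (1, True), (2, True), (0, False), (1, False), (2, False)}"
    by (auto simp: labeled_examples_def X_def)
  have tZ: "t c \<in> labeled_examples X" "models c (t c)" if "c \<in> C" "c \<noteq> {}" for c
    using that unfolding C_def Z by (auto simp: t simp del: One_nat_def)
  have t_inj: "t c \<noteq> t c'" if "c \<in> C" "c \<noteq> {}" "c' \<in> C" "c' \<noteq> {}" "c \<noteq> c'" for c c'
    using that unfolding C_def by (elim insertE emptyE; simp add: t del: One_nat_def)
  have "(\<Sum>c\<in>C. prior L c) = 1"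
  proof -
    have "(\<Sum>c\<in>C. prior L c) = prior L {} + (\<Sum>c\<in>C - {{}}. prior L c)"
      by (rule sum.remove[OF X(3) empty_C])
    also have "(\<Sum>c\<in>C - {{}}. prior L c) = (\<Sum>c\<in>C - {{}}. 1 / 8)"
      by (intro sum.cong) (auto simp: L_def)
    also have "\<dots> = real (card (C - {{}})) / 8" by simp
    also have "card (C - {{}}) = 6"
      using cardC empty_C by (simp add: card_Diff_singleton)
    finally show ?thesis by (simp add: L_def)
  qed
  moreover have "(\<Sum>z\<in>labeled_examples X. p c z) = 1" if "c \<in> C" for c
  proof (cases "c = {}")
    case True
    then show ?thesis by (simp add: Z p_def)
  next
    case False
    then show ?thesis
      using tZ(1)[OF that False] finite_labeled_examples[OF X(1)] by (simp add: p_def)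
  qed
  moreover have "p c z = 0" if "c \<in> C" "\<not> models c z" for c z
  proof (cases "c = {}")
    case True
    then have "snd z" using that(2) by (cases z) simp
    then show ?thesis using True by (simp add: p_def)
  next
    case False
    then have "z \<noteq> t c" using tZ(2)[OF that(1)] that(2) by metis
    then show ?thesis using False by (simp add: p_def)
  qed
  moreover have "0 \<le> p c z" for c z by (simp add: p_def)
  moreover have "0 < prior L c" for c by (simp add: L_def)
  moreover have "likelihood L = p" by (simp add: L_def)
  ultimately have L: "MAP_learner X C L" unfolding MAP_learner_def by metis
  \<comment> \<open>Samples of size at most 1 meet the size bound without replacement as soon as all
    supports are nonempty.\<close>
  have "N_plus X C L \<ge> 1"
  proof -
    have "card {z \<in> labeled_examples X. likelihood L c z > 0} \<ge> 1" if "c \<in> C" for c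
    proof -
      have "\<exists>z\<in>labeled_examples X. likelihood L c z > 0"
        using tZ(1)[OF that] by (cases "c = {}") (auto simp: L_def p_def Z)
      then show ?thesis
        using finite_labeled_examples[OF X(1)] by (auto simp: Suc_le_eq card_gt_0_iff)
    qed
    then show ?thesis using X(3,4) by (simp add: N_plus_def)
  qed
  moreover have "unique_maximizer (\<lambda>c'. prior L c' * sample_prob \<beta> (likelihood L c') (T c)) C c"
    if c: "c \<in> C" for c
  proof (rule unique_maximizerI[OF c])
    fix c' assume c': "c' \<in> C" "c' \<noteq> c"
    then show "prior L c' * sample_prob \<beta> (likelihood L c') (T c)
        < prior L c * sample_prob \<beta> (likelihood L c) (T c)"
      using t_inj[of c c'] c by (auto simp: L_def T_def p_def singleton_sample empty_sample)
  qed
  ultimately have "is_teacher \<alpha> \<beta> X C L T"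
    using tZ(1) by (auto simp: is_teacher_def T_def singleton_sample empty_sample)
  then have "MAP_TD_learner \<alpha> \<beta> X C L \<le> enat (teacher_order C T)"
    unfolding MAP_TD_learner_def by (auto intro: INF_lower)
  also have "teacher_order C T \<le> 1"
    using X(3,4) by (simp add: teacher_order_le T_def singleton_sample empty_sample)
  finally have "MAP_TD_learner \<alpha> \<beta> X C L \<le> 1" by (simp add: one_enat_def)
  moreover have "MAP_TD \<alpha> \<beta> X C \<le> MAP_TD_learner \<alpha> \<beta> X C L"
    unfolding MAP_TD_def using L by (auto intro: INF_lower)
  ultimately show "MAP_TD \<alpha> \<beta> X C \<le> 1" by simp
qed

theorem theorem5p6:
  fixes \<alpha> :: ordering and \<beta> :: replacement
  assumes "(\<alpha>, \<beta>) \<noteq> (Ordered, With_Repl)"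
  shows "(\<forall>(X :: 'a set) C. labeled_example_triple X C \<longrightarrow>
            MAP_TD \<alpha> \<beta> X C \<le> MLE_TD \<alpha> \<beta> X C \<and> MLE_TD \<alpha> \<beta> X C \<le> 1 + MAP_TD \<alpha> \<beta> X C) \<and>
         (\<exists>(X' :: nat set) C'. labeled_example_triple X' C' \<and>
            MLE_TD \<alpha> \<beta> X' C' = MAP_TD \<alpha> \<beta> X' C') \<and>
         (\<exists>(X'' :: nat set) C''. labeled_example_triple X'' C'' \<and>
            MLE_TD \<alpha> \<beta> X'' C'' = 1 + MAP_TD \<alpha> \<beta> X'' C'')"
proof (intro conjI allI impI)
  fix X :: "'a set" and C
  assume tr: "labeled_example_triple X C"
  show "MAP_TD \<alpha> \<beta> X C \<le> MLE_TD \<alpha> \<beta> X C" by (rule MAP_TD_le_MLE_TD)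
  show "MLE_TD \<alpha> \<beta> X C \<le> 1 + MAP_TD \<alpha> \<beta> X C" by (rule MLE_TD_le_Suc_MAP_TD[OF assms tr])
next
  show "\<exists>(X' :: nat set) C'. labeled_example_triple X' C' \<and> MLE_TD \<alpha> \<beta> X' C' = MAP_TD \<alpha> \<beta> X' C'"
    by (intro exI conjI) (rule MLE_TD_two_concepts[OF assms])+
next
  let ?X = "{0, 1, 2 :: nat}" and ?C = "{{}, {0}, {1}, {2}, {1, 2}, {0, 2}, {0, 1 :: nat}}"
  note seven = MAP_TD_seven_concepts
  have "MLE_TD \<alpha> \<beta> ?X ?C = 1 + MAP_TD \<alpha> \<beta> ?X ?C"
  proof (rule order_antisym)
    show "MLE_TD \<alpha> \<beta> ?X ?C \<le> 1 + MAP_TD \<alpha> \<beta> ?X ?C"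
      by (rule MLE_TD_le_Suc_MAP_TD[OF assms seven(1)])
    have "1 + MAP_TD \<alpha> \<beta> ?X ?C \<le> 1 + 1" by (rule add_left_mono[OF seven(3)])
    also have "\<dots> = 2" by (rule one_add_one)
    also have "\<dots> \<le> MLE_TD \<alpha> \<beta> ?X ?C" by (rule MLE_TD_ge_2[OF seven(1,2)])
    finally show "1 + MAP_TD \<alpha> \<beta> ?X ?C \<le> MLE_TD \<alpha> \<beta> ?X ?C" .
  qed
  with seven(1) show "\<exists>(X'' :: nat set) C''. labeled_example_triple X'' C'' \<and>
      MLE_TD \<alpha> \<beta> X'' C'' = 1 + MAP_TD \<alpha> \<beta> X'' C''"
    by (intro exI conjI)
qed

end
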